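(* Let $f,h$ satisfy (A1)--(A3) and consider the sequences generated by the AC-ACG method (both described in the context). The following statements hold: (a) for every $k\ge 1$ (such that $v_k$ is generated), $v_k\in\nabla f(y_k^g)+\partial h(y_k^g)$; (b) for every $k\ge 12$ (such that $v_1,\dots,v_k$ and $M_0,\dots,M_k$ are generated), $$\min_{1\le i\le k}\|v_i\|^2=\mathcal{O}\left(\frac{M_k^2D^2}{\gamma k^2}+\frac{\theta_k\,\bar m\,M_kD^2}{k}\right),\qquad \theta_k:=\max\left\{\frac{M_k}{M_i}:0\le i\le k\right\}\ge 1,$$ where the constant hidden in $\mathcal{O}(\cdot)$ is a universal constant, i.e. there is an absolute constant $c>0$ (independent of $k$, $n$, $f$, $h$ and of all inputs of the method) such that the left-hand side is at most $c$ times the expression in parentheses.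
   Context: Problem and assumptions. $\mathbb{R}^n$ carries the Euclidean inner product and norm. Consider $\min\{\phi(z):=f(z)+h(z): z\in\mathbb{R}^n\}$ where: (A1) $h:\mathbb{R}^n\to(-\infty,\infty]$ is proper, lower semicontinuous and convex; (A2) $f$ is real-valued, differentiable on $\mathrm{dom}\,h=\{z:h(z)<\infty\}$ and nonconvex on $\mathrm{dom}\,h$, and there exist scalars $m\ge0$, $M\ge0$ such that for all $u,u'\in\mathrm{dom}\,h$, $-\frac m2\|u-u'\|^2\le f(u)-\ell_f(u;u')$ and $\|\nabla f(u)-\nabla f(u')\|\le M\|u-u'\|$, where $\ell_f(u;u'):=f(u')+\langle\nabla f(u'),u-u'\rangle$; (A3) $D:=\sup\{\|u-u'\|:u,u'\in\mathrm{dom}\,h\}<\infty$. Let $\bar m$ (resp. $\bar M$) be the smallest $m\ge0$ (resp. $M\ge0$) satisfying the first (resp. second) inequality in (A2). $\partial h$ is the convex subdifferential. Notation. $\mathcal{C}(y;\tilde x):=\dfrac{2[f(y)-\ell_f(y;\tilde x)]}{\|y-\tilde x\|^2}$ (with the convention $\mathcal{C}(y;\tilde x)=0$ if $y=\tilde x$), and $y(\tilde x;L):=\mathrm{argmin}_x\{\ell_f(x;\tilde x)+h(x)+\frac L2\|x-\tilde x\|^2\}$ for $L>0$. AC-ACG method. Step 0. Given $\gamma\in(0,1)$, $M\ge\bar M$, a tolerance $\hat\rho>0$ and $y_0\in\mathrm{dom}\,h$, set $A_0=0$, $x_0=y_0$, $M_0=\gamma M$, $k=0$, and $\alpha=\frac{0.9}{8}\left(1+\frac1{0.9\gamma}\right)^{-1}$.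 Step 1. Compute $a_k=\frac{1+\sqrt{1+4M_kA_k}}{2M_k}$, $A_{k+1}=A_k+a_k$, $\tilde x_k=\frac{A_ky_k+a_kx_k}{A_{k+1}}$. Step 2. Set $y_{k+1}^g=y(\tilde x_k;M_k)$ and compute $x_{k+1}=\mathrm{argmin}_{u\in\mathbb{R}^n}\{a_k[\ell_f(u;\tilde x_k)+h(u)]+\frac12\|u-x_k\|^2\}$ and $v_{k+1}=M_k(\tilde x_k-y_{k+1}^g)+\nabla f(y_{k+1}^g)-\nabla f(\tilde x_k)$. Step 3. If $\|v_{k+1}\|\le\hat\rho$, output $(y_{k+1}^g,v_{k+1})$ and stop; otherwise compute $C_k=\max\left\{\mathcal{C}(y_{k+1}^g;\tilde x_k),\frac{\|\nabla f(y_{k+1}^g)-\nabla f(\tilde x_k)\|}{\|y_{k+1}^g-\tilde x_k\|}\right\}$, $C_k^{avg}=\frac1{k+1}\sum_{j=0}^kC_j$, $M_{k+1}=\max\{\frac1\alpha C_k^{avg},\gamma M\}$. Step 4. Set $y_{k+1}=y_{k+1}^b:=\frac{A_ky_k+a_kx_{k+1}}{A_{k+1}}$ if $C_k>0.9M_k$, and $y_{k+1}=y_{k+1}^g$ otherwise; set $k\leftarrow k+1$ and go to Step 1. (If $y_{k+1}^g=\tilde x_k$ then $v_{k+1}=0$ and the method stops, so $C_k$ is well defined whenever computed.) Convention. Statements "for every $k$" concern those indices $k$ for which all quantities involved are actually generated by the method. *)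

theory Defs
  imports "HOL-Analysis.Analysis"
begin

section \<open>The spaces \<open>\<real>\<^sup>n\<close> for all \<open>n\<close> inside one type\<close>

text \<open>
  The constant hidden in the complexity bound must not depend on the dimension, so \<open>n\<close> has to be
  quantified inside the formula, which a type-indexed \<open>real ^ 'n\<close> does not allow.
  The type \<open>fseq\<close> of finitely supported real sequences is an inner product space (though not a
  complete one), and \<open>\<real>\<^sup>n\<close> is its subspace \<open>Rn n\<close> of sequences vanishing from index \<open>n\<close> on.  The
  lemmas \<open>inner_Rn\<close>, \<open>Rn_eqI\<close> and \<open>Rn_exists\<close> confirm that this is Euclidean \<open>n\<close>-space.
\<close>

typedef fseq = "{x :: nat \<Rightarrow> real. finite {i. x i \<noteq> 0}}"
  morphisms coord Abs_fseq
  by (intro exI[of _ "\<lambda>_. 0"]) simp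

lemma finite_coord: "finite {i. coord x i \<noteq> 0}"
  using coord[of x] by simp

lemma coord_Abs: "finite {i. x i \<noteq> 0} \<Longrightarrow> coord (Abs_fseq x) = x"
  by (simp add: Abs_fseq_inverse)

lemma fseq_eqI: "(\<And>i. coord x i = coord y i) \<Longrightarrow> x = y"
  by (metis coord_inject ext)

instantiation fseq :: real_vector
begin

definition "0 = Abs_fseq (\<lambda>_. 0)"
definition "x + y = Abs_fseq (\<lambda>i. coord x i + coord y i)"
definition "x - y = Abs_fseq (\<lambda>i. coord x i - coord y i)"
definition "- x = Abs_fseq (\<lambda>i. - coord x i)"
definition "r *\<^sub>R x = Abs_fseq (\<lambda>i. r * coord x i)"

lemma coord_zero [simp]: "coord 0 i = 0"
  by (simp add: zero_fseq_def coord_Abs)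

lemma coord_add [simp]: "coord (x + y) i = coord x i + coord y i"
proof -
  have "finite {i. coord x i + coord y i \<noteq> 0}"
    by (rule finite_subset[OF _ finite_UnI[OF finite_coord[of x] finite_coord[of y]]]) auto
  then show ?thesis by (simp add: plus_fseq_def coord_Abs)
qed

lemma coord_diff [simp]: "coord (x - y) i = coord x i - coord y i"
proof -
  have "finite {i. coord x i - coord y i \<noteq> 0}"
    by (rule finite_subset[OF _ finite_UnI[OF finite_coord[of x] finite_coord[of y]]]) auto
  then show ?thesis by (simp add: minus_fseq_def coord_Abs)
qed

lemma coord_uminus [simp]: "coord (- x) i = - coord x i"
  by (simp add: uminus_fseq_def coord_Abs finite_coord)

lemma coord_scaleR [simp]: "coord (r *\<^sub>R x) i = r * coord x i"
proof -
  have "finite {i. r * coord x i \<noteq> 0}"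
    by (rule finite_subset[OF _ finite_coord[of x]]) auto
  then show ?thesis by (simp add: scaleR_fseq_def coord_Abs)
qed

instance
  by standard (auto intro!: fseq_eqI simp: algebra_simps)

end

instantiation fseq :: real_inner
begin

definition "inner x y = (\<Sum>i | coord x i \<noteq> 0. coord x i * coord y i)"
definition "norm x = sqrt (inner x x)" for x :: fseq
definition "sgn x = x /\<^sub>R norm x" for x :: fseq
definition "dist x y = norm (x - y)" for x y :: fseq
definition "uniformity = (INF e\<in>{0 <..}. principal {(x :: fseq, y). dist x y < e})"
definition "open U \<longleftrightarrow> (\<forall>x\<in>U. eventually (\<lambda>(x', y). x' = x \<longrightarrow> y \<in> U) uniformity)"
  for U :: "fseq set"

lemma inner_fseq_eq_sum:
  assumes "finite S" "\<And>i. i \<notin> S \<Longrightarrow> coord x i = 0 \<or> coord y i = 0"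
  shows "inner x y = (\<Sum>i\<in>S. coord x i * coord y i)"
  unfolding inner_fseq_def
  by (rule sum.mono_neutral_cong) (use assms finite_coord[of x] in auto)

instance
proof
  fix x y z :: fseq and r :: real
  define S where "S = {i. coord x i \<noteq> 0} \<union> {i. coord y i \<noteq> 0}"
  have S: "finite S" by (simp add: S_def finite_coord)
  have out: "coord x i = 0" "coord y i = 0" if "i \<notin> S" for i
    using that by (auto simp: S_def)
  show "dist x y = norm (x - y)" by (fact dist_fseq_def)
  show "sgn x = inverse (norm x) *\<^sub>R x" by (fact sgn_fseq_def)
  show "uniformity = (INF e\<in>{0 <..}. principal {(x :: fseq, y). dist x y < e})"
    by (fact uniformity_fseq_def)
  show "open U \<longleftrightarrow> (\<forall>x\<in>U. eventually (\<lambda>(x', y). x' = x \<longrightarrow> y \<in> U) uniformity)"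
    for U :: "fseq set"
    by (fact open_fseq_def)
  show "inner x y = inner y x"
    using inner_fseq_eq_sum[OF S, of x y] inner_fseq_eq_sum[OF S, of y x] out
    by (simp add: mult.commute)
  show "inner (x + y) z = inner x z + inner y z"
    using inner_fseq_eq_sum[OF S, of "x + y" z] inner_fseq_eq_sum[OF S, of x z]
      inner_fseq_eq_sum[OF S, of y z] out
    by (simp add: algebra_simps sum.distrib)
  show "inner (r *\<^sub>R x) y = r * inner x y"
    using inner_fseq_eq_sum[OF S, of "r *\<^sub>R x" y] inner_fseq_eq_sum[OF S, of x y] out
    by (simp add: sum_distrib_left mult.assoc)
  show "0 \<le> inner x x"
    unfolding inner_fseq_def by (intro sum_nonneg) simp
  have "x = 0" if "inner x x = 0"
  proof (rule fseq_eqI)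
    have "\<forall>i\<in>{i. coord x i \<noteq> 0}. coord x i * coord x i = 0"
      using that finite_coord[of x] unfolding inner_fseq_def
      by (subst (asm) sum_nonneg_eq_0_iff) auto
    then show "coord x i = coord 0 i" for i by auto
  qed
  moreover have "inner x x = 0" if "x = 0"
    using that by (simp add: inner_fseq_def)
  ultimately show "inner x x = 0 \<longleftrightarrow> x = 0" by blast
  show "norm x = sqrt (inner x x)" by (fact norm_fseq_def)
qed

end

definition Rn :: "nat \<Rightarrow> fseq set" where
  "Rn n = {x. \<forall>i\<ge>n. coord x i = 0}"

lemma subspace_Rn: "subspace (Rn n)"
  by (auto simp: Rn_def subspace_def)

lemma inner_Rn: "x \<in> Rn n \<Longrightarrow> x \<bullet> y = (\<Sum>i<n. coord x i * coord y i)"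
  by (rule inner_fseq_eq_sum) (auto simp: Rn_def not_less)

lemma Rn_eqI:
  assumes "x \<in> Rn n" "y \<in> Rn n" "\<And>i. i < n \<Longrightarrow> coord x i = coord y i"
  shows "x = y"
proof (rule fseq_eqI)
  show "coord x i = coord y i" for i
    using assms by (cases "i < n") (auto simp: Rn_def)
qed

lemma Rn_exists: "\<exists>x\<in>Rn n. \<forall>i<n. coord x i = c i"
proof -
  have "finite {i. (if i < n then c i else 0) \<noteq> 0}"
    by (rule finite_subset[of _ "{..<n}"]) (auto split: if_splits)
  then have "coord (Abs_fseq (\<lambda>i. if i < n then c i else 0)) = (\<lambda>i. if i < n then c i else 0)"
    by (rule coord_Abs)
  then show ?thesis
    by (intro bexI[of _ "Abs_fseq (\<lambda>i. if i < n then c i else 0)"]) (auto simp: Rn_def)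
qed


section \<open>The composite problem\<close>

definition effdom :: "nat \<Rightarrow> (fseq \<Rightarrow> ereal) \<Rightarrow> fseq set" where
  "effdom n h = {z \<in> Rn n. h z < \<infinity>}"

definition proper_on :: "nat \<Rightarrow> (fseq \<Rightarrow> ereal) \<Rightarrow> bool" where
  "proper_on n h \<longleftrightarrow> (\<forall>z\<in>Rn n. h z \<noteq> -\<infinity>) \<and> effdom n h \<noteq> {}"

definition lsc_on :: "nat \<Rightarrow> (fseq \<Rightarrow> ereal) \<Rightarrow> bool" where
  "lsc_on n h \<longleftrightarrow> (\<forall>z\<in>Rn n. h z \<le> Liminf (at z within Rn n) h)"

definition econvex_on :: "nat \<Rightarrow> (fseq \<Rightarrow> ereal) \<Rightarrow> bool" where
  "econvex_on n h \<longleftrightarrow> (\<forall>x\<in>Rn n. \<forall>y\<in>Rn n. \<forall>t. 0 < t \<and> t < 1 \<longrightarrow>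
     h ((1 - t) *\<^sub>R x + t *\<^sub>R y) \<le> ereal (1 - t) * h x + ereal t * h y)"

definition subdifferential :: "nat \<Rightarrow> (fseq \<Rightarrow> ereal) \<Rightarrow> fseq \<Rightarrow> fseq set" where
  "subdifferential n h x =
     {s \<in> Rn n. x \<in> effdom n h \<and> (\<forall>u\<in>Rn n. h u \<ge> h x + ereal (s \<bullet> (u - x)))}"

text \<open>
  \<open>gradient_on n S f g\<close>: on \<open>S\<close>, \<open>g\<close> is the gradient of \<open>f\<close>.  The derivative is taken within \<open>S\<close>,
  so \<open>f\<close> matters only on \<open>S\<close>.  If \<open>f\<close> is differentiable at the points of \<open>S\<close> as a function on
  \<open>\<real>\<^sup>n\<close>, its usual gradient satisfies this; if \<open>S\<close> is convex with nonempty interior in \<open>\<real>\<^sup>n\<close>, no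
  other \<open>g\<close> does (up to its values outside \<open>S\<close>).
\<close>

definition gradient_on :: "nat \<Rightarrow> fseq set \<Rightarrow> (fseq \<Rightarrow> real) \<Rightarrow> (fseq \<Rightarrow> fseq) \<Rightarrow> bool" where
  "gradient_on n S f g \<longleftrightarrow>
     (\<forall>u\<in>S. g u \<in> Rn n \<and> (f has_derivative (\<lambda>d. g u \<bullet> d)) (at u within S))"

text \<open>In the following, \<open>f\<close> and its gradient \<open>g\<close> are passed as separate arguments.\<close>

definition linapprox :: "(fseq \<Rightarrow> real) \<Rightarrow> (fseq \<Rightarrow> fseq) \<Rightarrow> fseq \<Rightarrow> fseq \<Rightarrow> real" where
  "linapprox f g u u' = f u' + g u' \<bullet> (u - u')"

definition weakly_convex_const ::
  "nat \<Rightarrow> (fseq \<Rightarrow> real) \<Rightarrow> (fseq \<Rightarrow> fseq) \<Rightarrow> (fseq \<Rightarrow> ereal) \<Rightarrow> real \<Rightarrow> bool" where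
  "weakly_convex_const n f g h m \<longleftrightarrow> 0 \<le> m \<and>
     (\<forall>u\<in>effdom n h. \<forall>u'\<in>effdom n h. - (m / 2) * (norm (u - u'))\<^sup>2 \<le> f u - linapprox f g u u')"

definition lipschitz_grad_const ::
  "nat \<Rightarrow> (fseq \<Rightarrow> fseq) \<Rightarrow> (fseq \<Rightarrow> ereal) \<Rightarrow> real \<Rightarrow> bool" where
  "lipschitz_grad_const n g h M \<longleftrightarrow> 0 \<le> M \<and>
     (\<forall>u\<in>effdom n h. \<forall>u'\<in>effdom n h. norm (g u - g u') \<le> M * norm (u - u'))"

definition mbar :: "nat \<Rightarrow> (fseq \<Rightarrow> real) \<Rightarrow> (fseq \<Rightarrow> fseq) \<Rightarrow> (fseq \<Rightarrow> ereal) \<Rightarrow> real" where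
  "mbar n f g h = (LEAST m. weakly_convex_const n f g h m)"

definition Mbar :: "nat \<Rightarrow> (fseq \<Rightarrow> fseq) \<Rightarrow> (fseq \<Rightarrow> ereal) \<Rightarrow> real" where
  "Mbar n g h = (LEAST M. lipschitz_grad_const n g h M)"

definition dom_dists :: "nat \<Rightarrow> (fseq \<Rightarrow> ereal) \<Rightarrow> real set" where
  "dom_dists n h = {norm (u - u') |u u'. u \<in> effdom n h \<and> u' \<in> effdom n h}"

definition dom_diam :: "nat \<Rightarrow> (fseq \<Rightarrow> ereal) \<Rightarrow> real" where
  "dom_diam n h = Sup (dom_dists n h)"

locale composite_problem =
  fixes n :: nat and f :: "fseq \<Rightarrow> real" and g :: "fseq \<Rightarrow> fseq" and h :: "fseq \<Rightarrow> ereal"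
  assumes h_proper: "proper_on n h"
    and h_lsc: "lsc_on n h"
    and h_convex: "econvex_on n h"
    and f_gradient: "gradient_on n (effdom n h) f g"
    and f_nonconvex: "\<not> convex_on (effdom n h) f"
    and f_weakly_convex: "\<exists>m. weakly_convex_const n f g h m"
    and f_lipschitz_grad: "\<exists>M. lipschitz_grad_const n g h M"
    and dom_bounded: "bdd_above (dom_dists n h)"


section \<open>The AC-ACG method\<close>

definition curvature :: "(fseq \<Rightarrow> real) \<Rightarrow> (fseq \<Rightarrow> fseq) \<Rightarrow> fseq \<Rightarrow> fseq \<Rightarrow> real" where
  "curvature f g y x =
     (if y = x then 0 else 2 * (f y - linapprox f g y x) / (norm (y - x))\<^sup>2)"

definition acacg_alpha :: "real \<Rightarrow> real" where
  "acacg_alpha \<gamma> = (0.9 / 8) * inverse (1 + 1 / (0.9 * \<gamma>))"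

text \<open>
  \<open>reached \<rho> v k\<close>: the stopping test has failed for \<open>v\<^sub>1, \<dots>, v\<^sub>k\<close>, so the method starts iteration \<open>k\<close>
  (\<open>k = 0, 1, \<dots>\<close>).  For \<open>k \<ge> 1\<close>, \<open>M\<^sub>k\<close> and \<open>y\<^sub>k\<close> (and \<open>C\<^sub>j\<close> for \<open>j = k - 1\<close>) are therefore
  generated if and only if \<open>reached \<rho> v k\<close>, whereas \<open>x\<^sub>k\<close>, \<open>y\<^sup>g\<^sub>k\<close> and \<open>v\<^sub>k\<close> are generated if and only
  if \<open>reached \<rho> v (k - 1)\<close>.
\<close>

definition reached :: "real \<Rightarrow> (nat \<Rightarrow> fseq) \<Rightarrow> nat \<Rightarrow> bool" where
  "reached \<rho> v k \<longleftrightarrow> (\<forall>i\<in>{1..k}. norm (v i) > \<rho>)"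

text \<open>
  A run is given by total sequences that are constrained only at indices the method reaches; the
  remaining entries are arbitrary.  \<open>M\<close> is the input scalar and \<open>Ms\<close> the sequence \<open>M\<^sub>0, M\<^sub>1, \<dots>\<close>;
  \<open>xt\<close> is the sequence of the \<open>\<tilde>x\<^sub>k\<close>.
\<close>

locale acacg_run = composite_problem n f g h
  for n :: nat and f :: "fseq \<Rightarrow> real" and g :: "fseq \<Rightarrow> fseq" and h :: "fseq \<Rightarrow> ereal" +
  fixes \<gamma> M \<rho> :: real and y0 :: fseq
    and A a Ms C :: "nat \<Rightarrow> real"
    and x y xt yg v :: "nat \<Rightarrow> fseq"
  assumes gamma: "0 < \<gamma>" "\<gamma> < 1"
    and M_ge: "M \<ge> Mbar n g h"
    and rho_pos: "\<rho> > 0"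
    and y0_dom: "y0 \<in> effdom n h"
    and step0: "A 0 = 0" "x 0 = y0" "y 0 = y0" "Ms 0 = \<gamma> * M"
    and step1_a: "\<And>k. reached \<rho> v k \<Longrightarrow> a k = (1 + sqrt (1 + 4 * Ms k * A k)) / (2 * Ms k)"
    and step1_A: "\<And>k. reached \<rho> v k \<Longrightarrow> A (Suc k) = A k + a k"
    and step1_xt: "\<And>k. reached \<rho> v k \<Longrightarrow> xt k = (A k *\<^sub>R y k + a k *\<^sub>R x k) /\<^sub>R A (Suc k)"
    and step2_yg: "\<And>k. reached \<rho> v k \<Longrightarrow>
      is_arg_min (\<lambda>u. ereal (linapprox f g u (xt k)) + h u
                      + ereal (Ms k / 2 * (norm (u - xt k))\<^sup>2))
                 (\<lambda>u. u \<in> Rn n) (yg (Suc k))"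
    and step2_x: "\<And>k. reached \<rho> v k \<Longrightarrow>
      is_arg_min (\<lambda>u. ereal (a k) * (ereal (linapprox f g u (xt k)) + h u)
                      + ereal (1 / 2 * (norm (u - x k))\<^sup>2))
                 (\<lambda>u. u \<in> Rn n) (x (Suc k))"
    and step2_v: "\<And>k. reached \<rho> v k \<Longrightarrow>
      v (Suc k) = Ms k *\<^sub>R (xt k - yg (Suc k)) + g (yg (Suc k)) - g (xt k)"
    and step3_C: "\<And>k. reached \<rho> v (Suc k) \<Longrightarrow>
      C k = max (curvature f g (yg (Suc k)) (xt k))
                (norm (g (yg (Suc k)) - g (xt k)) / norm (yg (Suc k) - xt k))"
    and step3_M: "\<And>k. reached \<rho> v (Suc k) \<Longrightarrow>
      Ms (Suc k) = max (1 / acacg_alpha \<gamma> * ((1 / real (k + 1)) * (\<Sum>j=0..k. C j))) (\<gamma> * M)"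
    and step4: "\<And>k. reached \<rho> v (Suc k) \<Longrightarrow>
      y (Suc k) = (if C k > 0.9 * Ms k then (A k *\<^sub>R y k + a k *\<^sub>R x (Suc k)) /\<^sub>R A (Suc k)
                   else yg (Suc k))"

definition acacg_theta :: "(nat \<Rightarrow> real) \<Rightarrow> nat \<Rightarrow> real" where
  "acacg_theta Ms k = Max {Ms k / Ms i |i. 0 \<le> i \<and> i \<le> k}"

end

theory Submission
  imports Defs
begin

text \<open>
  The inclusion for \<open>v\<close> is Fermat's rule for the proximal step that defines \<open>yg\<close>
  (\<open>v_in_subdifferential\<close>).

  For the complexity bound, call iteration \<open>k\<close> good if \<open>C\<^sub>k \<le> 0.9 M\<^sub>k\<close> and bad otherwise, and write
  \<open>D\<close> for the diameter of the domain and \<open>\<phi> = f + h\<close>.  The usual potential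
  \<open>A\<^sub>k (\<phi>(y\<^sub>k) - \<phi>(u)) + \<parallel>u - x\<^sub>k\<parallel>\<^sup>2 / 2\<close> of accelerated gradient methods increases, by
  nonconvexity, by at most \<open>mbar D\<^sup>2 a\<^sub>k\<close> in each iteration and by at most another \<open>D\<^sup>2 / (2 \<gamma>)\<close> in a
  bad one; in a good iteration it also decreases by
  \<open>A\<^sub>k\<^sub>+\<^sub>1 M\<^sub>k \<parallel>yg\<^sub>k\<^sub>+\<^sub>1 - xt\<^sub>k\<parallel>\<^sup>2 / 20\<close> (\<open>potential_step\<close>).  Summing these estimates bounds the sum of the
  decreases by \<open>k D\<^sup>2 / \<gamma> + mbar D\<^sup>2 A\<^sub>k\<close> (\<open>sum_good_residuals\<close>), and in a good iteration
  \<open>\<parallel>v\<^sub>k\<^sub>+\<^sub>1\<parallel> \<le> 2 M\<^sub>k \<parallel>yg\<^sub>k\<^sub>+\<^sub>1 - xt\<^sub>k\<parallel>\<close>.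

  It remains to see that there are many good iterations with a large weight \<open>A\<^sub>j\<^sub>+\<^sub>1 / M\<^sub>j\<close>.  At most
  \<open>1 + k / 8\<close> iterations are bad: every bad \<open>C\<^sub>i\<close> is at least \<open>0.9 \<gamma> M\<close> and so keeps the average of
  the \<open>C\<^sub>i\<close> up, but a bad \<open>C\<^sub>j\<close>, which is at most \<open>M\<close>, must exceed a large multiple of the average
  of its predecessors (\<open>card_bad_le\<close>).  So at
  least \<open>k / 4\<close> indices in the second half are good if \<open>k \<ge> 12\<close>.  The average changes slowly, in that
  \<open>j M\<^sub>j \<le> k M\<^sub>k\<close> for \<open>j \<le> k\<close> (\<open>index_times_Ms_mono\<close>); therefore \<open>M\<^sub>j \<le> 2 M\<^sub>k\<close> in the second half, and
  \<open>A\<^sub>j\<^sub>+\<^sub>1\<close> is there at least a constant times \<open>k\<^sup>2 / M\<^sub>k\<close>.  Hence the minimum of the \<open>\<parallel>v\<^sub>i\<parallel>\<^sup>2\<close>, times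
  \<open>k\<^sup>3 / M\<^sub>k\<^sup>2\<close>, is at most a constant times \<open>k D\<^sup>2 / \<gamma> + mbar D\<^sup>2 A\<^sub>k\<close>, and \<open>A\<^sub>k \<le> \<theta>\<^sub>k k\<^sup>2 / M\<^sub>k\<close>
  (\<open>A_upper\<close>) gives the claim (\<open>min_residual_bound\<close>).
\<close>

section \<open>Inequalities for smooth and convex functions\<close>

text \<open>
  Along the segment \<open>p t = u' + t *\<^sub>R (u - u')\<close>, the difference \<open>q\<close> between \<open>f\<close> and the quadratic
  upper model has a nonpositive derivative, because \<open>g\<close> changes by at most \<open>L * t * norm (u - u')\<close>
  on the way; so the mean value theorem gives \<open>q 1 \<le> q 0\<close>.  Derivatives are taken within \<open>S\<close>, hence
  the segment must stay in \<open>S\<close>.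
\<close>

lemma descent_inequality:
  fixes f :: "'a::real_inner \<Rightarrow> real"
  assumes S: "convex S" "u \<in> S" "u' \<in> S"
    and deriv: "\<And>w. w \<in> S \<Longrightarrow> (f has_derivative (\<lambda>d. g w \<bullet> d)) (at w within S)"
    and lip: "\<And>w w'. w \<in> S \<Longrightarrow> w' \<in> S \<Longrightarrow> norm (g w - g w') \<le> L * norm (w - w')"
  shows "f u \<le> f u' + g u' \<bullet> (u - u') + L / 2 * (norm (u - u'))\<^sup>2"
proof -
  define d where "d = u - u'"
  define p where "p = (\<lambda>t::real. u' + t *\<^sub>R d)"
  have p_in: "p t \<in> S" if "0 \<le> t" "t \<le> 1" for t
  proof -
    have "p t = (1 - t) *\<^sub>R u' + t *\<^sub>R u" by (simp add: p_def d_def algebra_simps)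
    then show ?thesis using convexD_alt[OF S(1,3,2)] that by simp
  qed
  define q where "q = (\<lambda>t. f (p t) - t * (g u' \<bullet> d) - L / 2 * t\<^sup>2 * (norm d)\<^sup>2)"
  have q_deriv: "(q has_derivative
      (\<lambda>s. g (p t) \<bullet> (s *\<^sub>R d) - s * (g u' \<bullet> d) - L / 2 * (2 * t * s) * (norm d)\<^sup>2))
      (at t within {0..1})" if t: "0 \<le> t" "t \<le> 1" for t
  proof -
    have "((\<lambda>t. f (p t)) has_derivative (\<lambda>s. g (p t) \<bullet> (s *\<^sub>R d))) (at t within {0..1})"
    proof (rule has_derivative_in_compose2[where g = f and t = S and g' = "\<lambda>w d. g w \<bullet> d"])
      show "p ` {0..1} \<subseteq> S" using p_in by auto
      show "(p has_derivative (\<lambda>s. s *\<^sub>R d)) (at t within {0..1})"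
        unfolding p_def by (auto intro!: derivative_eq_intros)
    qed (use deriv t in auto)
    then show ?thesis
      unfolding q_def by (auto intro!: derivative_eq_intros)
  qed
  obtain t where t: "t \<in> {0..1}" and q_diff: "q 1 - q 0 =
      g (p t) \<bullet> ((1 - 0) *\<^sub>R d) - (1 - 0) * (g u' \<bullet> d) - L / 2 * (2 * t * (1 - 0)) * (norm d)\<^sup>2"
    using mvt_very_simple[OF zero_le_one q_deriv] by auto
  have "g (p t) \<bullet> d - g u' \<bullet> d \<le> norm (g (p t) - g u') * norm d"
    by (metis inner_diff_left norm_cauchy_schwarz)
  also have "\<dots> \<le> (L * norm (p t - u')) * norm d"
    by (intro mult_right_mono lip p_in S) (use t in auto)
  also have "\<dots> = L * t * (norm d)\<^sup>2"
    using t by (simp add: p_def power2_eq_square)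
  finally have "q 1 \<le> q 0" using q_diff by simp
  then show ?thesis
    by (simp add: q_def p_def d_def)
qed

text \<open>
  Fermat's rule for a proximal step: \<open>L *\<^sub>R (c - z)\<close> is a subgradient of \<open>\<psi>\<close> at the minimizer \<open>z\<close>.
  Moving from \<open>z\<close> a fraction \<open>t\<close> of the way to \<open>u\<close> changes the minimized function by at most
  \<open>t * (e + t * K)\<close>, where \<open>e\<close> is the gap in the claim; minimality makes this nonnegative, and
  \<open>t \<longrightarrow> 0\<close> gives \<open>0 \<le> e\<close>.
  This gives the inclusion for \<open>v\<close> as well as the strong convexity gain in the \<open>x\<close>-update.
\<close>

lemma proximal_optimality:
  fixes \<psi> :: "'a::real_inner \<Rightarrow> real"
  assumes conv: "convex_on S \<psi>" and z: "z \<in> S" and u: "u \<in> S"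
    and min: "\<And>w. w \<in> S \<Longrightarrow>
      \<psi> z + L / 2 * (norm (z - c))\<^sup>2 \<le> \<psi> w + L / 2 * (norm (w - c))\<^sup>2"
  shows "\<psi> z + L * ((c - z) \<bullet> (u - z)) \<le> \<psi> u"
proof -
  define e where "e = \<psi> u - \<psi> z - L * ((c - z) \<bullet> (u - z))"
  define K where "K = L / 2 * (norm (u - z))\<^sup>2"
  have small: "0 \<le> e + t * K" if t: "0 < t" "t < 1" for t
  proof -
    let ?w = "(1 - t) *\<^sub>R z + t *\<^sub>R u"
    have w: "?w \<in> S"
      using convexD_alt[OF convex_on_imp_convex[OF conv] z u] t by simp
    have eq: "(norm (?w - c))\<^sup>2
        = (norm (z - c))\<^sup>2 - 2 * t * ((c - z) \<bullet> (u - z)) + t\<^sup>2 * (norm (u - z))\<^sup>2"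
      unfolding power2_norm_eq_inner
      by (simp add: inner_simps inner_commute algebra_simps power2_eq_square)
    have "\<psi> z + L / 2 * (norm (z - c))\<^sup>2 \<le> \<psi> ?w + L / 2 * (norm (?w - c))\<^sup>2"
      by (rule min[OF w])
    also have "\<dots> \<le> (1 - t) * \<psi> z + t * \<psi> u + L / 2 * (norm (?w - c))\<^sup>2"
      using convex_onD[OF conv, of t z u] t z u by simp
    finally have "0 \<le> t * (e + t * K)"
      unfolding eq e_def K_def by (simp add: algebra_simps power2_eq_square)
    then show ?thesis using t by (simp add: zero_le_mult_iff)
  qed
  have "((\<lambda>t. e + t * K) \<longlongrightarrow> e + 0 * K) (at_right 0)"
    by (intro tendsto_intros)
  moreover have "\<forall>\<^sub>F t in at_right 0. 0 \<le> e + t * K"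
    using small by (auto simp: eventually_at_right[of 0 "1::real"] intro!: exI[of _ 1])
  ultimately have "0 \<le> e"
    using tendsto_lowerbound[of "\<lambda>t. e + t * K" "e + 0 * K" "at_right 0" 0] by simp
  then show ?thesis by (simp add: e_def)
qed

text \<open>
  The core inequality of accelerated gradient methods, for an arbitrary convex model \<open>\<psi>\<close>.  Since
  \<open>yb - xt\<close> is \<open>a / (A + a)\<close> times \<open>x' - x\<close>, the step-size equation \<open>L * a\<^sup>2 = A + a\<close> turns the
  quadratic term at \<open>yb\<close> into exactly half the squared length of the step from \<open>x\<close> to \<open>x'\<close>, which
  is the amount that the optimality of \<open>x'\<close> provides.  The bound on \<open>\<psi> yb\<close> is convexity.
\<close>

lemma accelerated_step:
  fixes \<psi> :: "'a::real_inner \<Rightarrow> real"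
  assumes conv: "convex_on S \<psi>" and S: "y \<in> S" "u \<in> S" "x' \<in> S"
    and pos: "0 < a" "0 \<le> A" and L: "L * a\<^sup>2 = A + a"
    and min: "\<And>w. w \<in> S \<Longrightarrow>
      a * \<psi> x' + 1 / 2 * (norm (x' - x))\<^sup>2 \<le> a * \<psi> w + 1 / 2 * (norm (w - x))\<^sup>2"
    and xt: "xt = (A *\<^sub>R y + a *\<^sub>R x) /\<^sub>R (A + a)"
    and yb: "yb = (A *\<^sub>R y + a *\<^sub>R x') /\<^sub>R (A + a)"
  shows "(A + a) * (L / 2 * (norm (yb - xt))\<^sup>2) = 1 / 2 * (norm (x' - x))\<^sup>2"
    and "(A + a) * (\<psi> yb + L / 2 * (norm (yb - xt))\<^sup>2)
      \<le> A * \<psi> y + a * \<psi> u + 1 / 2 * (norm (u - x))\<^sup>2 - 1 / 2 * (norm (u - x'))\<^sup>2"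
proof -
  have A': "A + a > 0" using pos by simp
  have "yb - xt = (a / (A + a)) *\<^sub>R (x' - x)"
    unfolding xt yb by (simp add: algebra_simps divide_inverse)
  then have "(norm (yb - xt))\<^sup>2 = a\<^sup>2 / (A + a)\<^sup>2 * (norm (x' - x))\<^sup>2"
    by (simp add: power_mult_distrib power_divide)
  then have "(A + a) * (L / 2 * (norm (yb - xt))\<^sup>2)
      = (L * a\<^sup>2) * (A + a) / (2 * (A + a)\<^sup>2) * (norm (x' - x))\<^sup>2"
    by simp
  also have "\<dots> = 1 / 2 * (norm (x' - x))\<^sup>2"
    unfolding L using A' by (simp add: power2_eq_square)
  finally show quad: "(A + a) * (L / 2 * (norm (yb - xt))\<^sup>2) = 1 / 2 * (norm (x' - x))\<^sup>2" .
  have coeff: "1 - a / (A + a) = A / (A + a)" using A' by (simp add: field_simps)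
  then have "yb = (1 - a / (A + a)) *\<^sub>R y + (a / (A + a)) *\<^sub>R x'"
    unfolding yb by (simp add: scaleR_add_right divide_inverse mult.commute)
  then have "\<psi> yb \<le> (1 - a / (A + a)) * \<psi> y + (a / (A + a)) * \<psi> x'"
    using convex_onD[OF conv, of "a / (A + a)" y x'] S pos by simp
  also have "\<dots> = (A * \<psi> y + a * \<psi> x') / (A + a)"
    unfolding coeff by (simp add: add_divide_distrib)
  finally have avg: "(A + a) * \<psi> yb \<le> A * \<psi> y + a * \<psi> x'"
    using A' by (simp add: pos_le_divide_eq mult.commute)
  have "a * \<psi> x' + 1 * ((x - x') \<bullet> (u - x')) \<le> a * \<psi> u"
    by (rule proximal_optimality[of S "\<lambda>w. a * \<psi> w" x' u 1 x])
      (use conv S min pos in \<open>auto intro!: convex_on_cmul\<close>)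
  moreover have "(norm (u - x))\<^sup>2
      = (norm (u - x'))\<^sup>2 + (norm (x' - x))\<^sup>2 - 2 * ((x - x') \<bullet> (u - x'))"
    unfolding power2_norm_eq_inner by (simp add: inner_simps inner_commute)
  ultimately show "(A + a) * (\<psi> yb + L / 2 * (norm (yb - xt))\<^sup>2)
      \<le> A * \<psi> y + a * \<psi> u + 1 / 2 * (norm (u - x))\<^sup>2 - 1 / 2 * (norm (u - x'))\<^sup>2"
    unfolding distrib_left quad using avg by linarith
qed

section \<open>The step-size recursion\<close>

lemma step_size_quadratic:
  fixes a A L :: real
  assumes "0 < L" "0 \<le> A" "a = (1 + sqrt (1 + 4 * L * A)) / (2 * L)"
  shows "0 < a" "L * a\<^sup>2 = A + a"
proof -
  have nonneg: "0 \<le> 1 + 4 * L * A" using assms by simp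
  show "0 < a" using assms nonneg by (auto intro!: divide_pos_pos add_pos_nonneg)
  have "2 * L * a - 1 = sqrt (1 + 4 * L * A)" using assms by simp
  then have "(2 * L * a - 1)\<^sup>2 = 1 + 4 * L * A" using nonneg by simp
  then have "4 * L * (L * a\<^sup>2 - (A + a)) = 0"
    by (simp add: power2_eq_square algebra_simps)
  then show "L * a\<^sup>2 = A + a" using assms by simp
qed

text \<open>
  Both bounds compare \<open>a\<close>, through \<open>2 * s * r \<le> sqrt (1 + 4 * L * A) \<le> 1 + 2 * s * r\<close> with
  \<open>s = sqrt L\<close> and \<open>r = sqrt A\<close>, with the completed squares of \<open>r + 1 / (2 * s)\<close> and \<open>r + 1 / s\<close>.
  They make \<open>sqrt A\<close> grow linearly: for constant \<open>L\<close>, \<open>A\<close> is of order \<open>k\<^sup>2 / L\<close> after \<open>k\<close> steps.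
\<close>

lemma sqrt_step_bounds:
  fixes a A L :: real
  assumes L: "0 < L" and A: "0 \<le> A" and a: "a = (1 + sqrt (1 + 4 * L * A)) / (2 * L)"
  shows "sqrt A + 1 / (2 * sqrt L) \<le> sqrt (A + a)" "sqrt (A + a) \<le> sqrt A + 1 / sqrt L"
proof -
  define s where "s = sqrt L"
  define r where "r = sqrt A"
  have s: "0 < s" "L = s\<^sup>2" and r: "0 \<le> r" "A = r\<^sup>2" using L A by (auto simp: s_def r_def)
  have root: "sqrt (1 + 4 * L * A) \<ge> 2 * s * r"
    by (rule real_le_rsqrt) (simp add: s r power_mult_distrib)
  have root': "sqrt (1 + 4 * L * A) \<le> 1 + 2 * s * r"
    by (rule real_le_lsqrt) (use s r in \<open>auto simp: power2_sum power_mult_distrib\<close>)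
  have "(r + 1 / (2 * s))\<^sup>2 = A + (1 / (4 * s\<^sup>2) + r / s)"
    by (simp add: r power2_sum power_mult_distrib power_divide)
  also have "\<dots> = A + (1 + 2 * (2 * s * r)) / (4 * s\<^sup>2)"
    using s by (simp add: add_divide_distrib power2_eq_square)
  also have "\<dots> \<le> A + (1 + sqrt (1 + 4 * L * A)) / (2 * s\<^sup>2)"
  proof -
    have "1 + 2 * (2 * s * r) \<le> 2 * (1 + sqrt (1 + 4 * L * A))" using root by simp
    then have "(1 + 2 * (2 * s * r)) / (4 * s\<^sup>2) \<le> 2 * (1 + sqrt (1 + 4 * L * A)) / (4 * s\<^sup>2)"
      by (rule divide_right_mono) simp
    moreover have "2 * X / (4 * s\<^sup>2) = X / (2 * s\<^sup>2)" for X by simp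
    ultimately show ?thesis by (metis add_left_mono)
  qed
  also have "\<dots> = A + a" unfolding a s(2) ..
  finally show "sqrt A + 1 / (2 * sqrt L) \<le> sqrt (A + a)"
    unfolding r_def[symmetric] s_def[symmetric] by (rule real_le_rsqrt)
  have "A + a \<le> A + (2 + 2 * s * r) / (2 * s\<^sup>2)"
    unfolding a s(2)[symmetric] using root' L by (intro add_left_mono divide_right_mono) auto
  also have "\<dots> \<le> A + (2 + 4 * s * r) / (2 * s\<^sup>2)"
    using s r by (intro add_left_mono divide_right_mono) auto
  also have "\<dots> = A + (1 / s\<^sup>2 + 2 * r / s)"
    using s by (simp add: add_divide_distrib power2_eq_square)
  also have "\<dots> = (r + 1 / s)\<^sup>2"
    by (simp add: r power2_sum power_divide)
  finally show "sqrt (A + a) \<le> sqrt A + 1 / sqrt L"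
    unfolding r_def[symmetric] s_def[symmetric]
    by (intro real_le_lsqrt) (use s r in \<open>auto intro!: add_nonneg_nonneg\<close>)
qed

section \<open>The composite problem\<close>

text \<open>
  \<open>LEAST\<close> on the reals says nothing unless a minimum exists.  Here the infimum belongs to the set
  because the set is closed and bounded below; so \<open>mbar\<close> and \<open>Mbar\<close> satisfy their defining
  inequalities.
\<close>

lemma Least_of_closed:
  fixes P :: "real \<Rightarrow> bool"
  assumes "closed {m. P m}" "P m0" "\<And>m. P m \<Longrightarrow> 0 \<le> m"
  shows "P (LEAST m. P m)"
proof -
  have bdd: "bdd_below {m. P m}" using assms(3) by (auto intro!: bdd_belowI[of _ 0])
  have "P (Inf {m. P m})"
    using closed_contains_Inf[OF _ bdd assms(1)] assms(2) by auto
  then have "(LEAST m. P m) = Inf {m. P m}"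
    by (rule Least_equality) (use bdd in \<open>auto intro: cInf_lower\<close>)
  then show ?thesis using \<open>P (Inf {m. P m})\<close> by simp
qed

lemma convex_on_linapprox: "convex S \<Longrightarrow> convex_on S (\<lambda>u. linapprox f g u c)"
  by (rule convex_onI) (auto simp: linapprox_def inner_simps algebra_simps)

context composite_problem
begin

lemma effdom_subset: "u \<in> effdom n h \<Longrightarrow> u \<in> Rn n"
  by (simp add: effdom_def)

lemma h_finite: "u \<in> effdom n h \<Longrightarrow> h u = ereal (real_of_ereal (h u))"
  using h_proper by (cases "h u") (auto simp: effdom_def proper_on_def)

lemma h_infinite: "u \<in> Rn n \<Longrightarrow> u \<notin> effdom n h \<Longrightarrow> h u = \<infinity>"
  by (auto simp: effdom_def)

lemma h_convex_step:
  assumes "u \<in> effdom n h" "w \<in> effdom n h" "0 < t" "t < 1"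
  shows "h ((1 - t) *\<^sub>R u + t *\<^sub>R w)
    \<le> ereal ((1 - t) * real_of_ereal (h u) + t * real_of_ereal (h w))"
proof -
  have "h ((1 - t) *\<^sub>R u + t *\<^sub>R w) \<le> ereal (1 - t) * h u + ereal t * h w"
    using h_convex assms by (simp add: econvex_on_def effdom_subset)
  also have "\<dots> = ereal ((1 - t) * real_of_ereal (h u) + t * real_of_ereal (h w))"
    by (subst h_finite[OF assms(1)], subst h_finite[OF assms(2)]) simp
  finally show ?thesis .
qed

lemma convex_effdom: "convex (effdom n h)"
  unfolding convex_alt
proof (intro ballI allI impI)
  fix u w :: fseq and t :: real
  assume uw: "u \<in> effdom n h" "w \<in> effdom n h" and t: "0 \<le> t \<and> t \<le> 1"
  have "(1 - t) *\<^sub>R u + t *\<^sub>R w \<in> Rn n"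
    using uw by (intro subspace_add subspace_scale subspace_Rn effdom_subset)
  moreover have "h ((1 - t) *\<^sub>R u + t *\<^sub>R w) < \<infinity>" if "0 < t" "t < 1"
    using h_convex_step[OF uw that] by (rule order.strict_trans1) simp
  ultimately show "(1 - t) *\<^sub>R u + t *\<^sub>R w \<in> effdom n h"
    using uw t by (cases "t = 0"; cases "t = 1") (auto simp: effdom_def)
qed

lemma convex_on_h: "convex_on (effdom n h) (\<lambda>u. real_of_ereal (h u))"
proof (rule convex_onI[OF _ convex_effdom])
  fix t :: real and u w :: fseq
  assume t: "0 < t" "t < 1" and uw: "u \<in> effdom n h" "w \<in> effdom n h"
  have "(1 - t) *\<^sub>R u + t *\<^sub>R w \<in> effdom n h"
    using convexD_alt[OF convex_effdom uw] t by simp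
  from h_finite[OF this] show "real_of_ereal (h ((1 - t) *\<^sub>R u + t *\<^sub>R w))
      \<le> (1 - t) * real_of_ereal (h u) + t * real_of_ereal (h w)"
    using h_convex_step[OF uw t] by (metis ereal_less_eq(3))
qed

lemma convex_on_model:
  "convex_on (effdom n h) (\<lambda>u. linapprox f g u c + real_of_ereal (h u))"
  by (intro convex_on_add convex_on_linapprox convex_on_h convex_effdom)

text \<open>
  Transfers a minimization of an extended-real function over \<open>Rn n\<close> to a real one over the effective
  domain: a minimizer cannot have infinite value because \<open>h\<close> is proper.
\<close>

lemma arg_min_in_effdom:
  assumes min: "is_arg_min F (\<lambda>u. u \<in> Rn n) z"
    and fin: "\<And>w. w \<in> effdom n h \<Longrightarrow> F w = ereal (G w)"
    and inf: "\<And>w. w \<in> Rn n \<Longrightarrow> w \<notin> effdom n h \<Longrightarrow> F w = \<infinity>"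
  shows "z \<in> effdom n h" and "w \<in> effdom n h \<Longrightarrow> G z \<le> G w"
proof -
  have z: "z \<in> Rn n" using min by (simp add: is_arg_min_def)
  have le: "F z \<le> F w" if "w \<in> Rn n" for w
    using min that by (auto simp: is_arg_min_def not_less)
  obtain w0 where w0: "w0 \<in> effdom n h"
    using h_proper by (auto simp: proper_on_def)
  show z_dom: "z \<in> effdom n h"
  proof (rule ccontr)
    assume "z \<notin> effdom n h"
    then show False using le[OF effdom_subset[OF w0]] fin[OF w0] inf[OF z] by simp
  qed
  show "G z \<le> G w" if "w \<in> effdom n h"
    using le[OF effdom_subset[OF that]] fin[OF that] fin[OF z_dom] by simp
qed

lemma mbar_weakly_convex: "weakly_convex_const n f g h (mbar n f g h)"
proof -
  have "closed {m. weakly_convex_const n f g h m}"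
    unfolding weakly_convex_const_def Ball_def
    by (intro closed_Collect_conj closed_Collect_all closed_Collect_imp open_Collect_const
        closed_Collect_le continuous_intros) simp
  then show ?thesis
    unfolding mbar_def using f_weakly_convex
    by (elim exE) (rule Least_of_closed, auto simp: weakly_convex_const_def)
qed

lemma Mbar_lipschitz_grad: "lipschitz_grad_const n g h (Mbar n g h)"
proof -
  have "closed {L. lipschitz_grad_const n g h L}"
    unfolding lipschitz_grad_const_def Ball_def
    by (intro closed_Collect_conj closed_Collect_all closed_Collect_imp open_Collect_const
        closed_Collect_le continuous_intros)
  then show ?thesis
    unfolding Mbar_def using f_lipschitz_grad
    by (elim exE) (rule Least_of_closed, auto simp: lipschitz_grad_const_def)
qed

lemma descent:
  assumes "lipschitz_grad_const n g h L" "u \<in> effdom n h" "u' \<in> effdom n h"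
  shows "f u \<le> linapprox f g u u' + L / 2 * (norm (u - u'))\<^sup>2"
  unfolding linapprox_def
  by (rule descent_inequality[of "effdom n h"])
    (use assms convex_effdom f_gradient in \<open>auto simp: gradient_on_def lipschitz_grad_const_def\<close>)

text \<open>
  With constant \<open>0\<close>, the descent inequality for \<open>- f\<close> says that \<open>f\<close> lies above all its
  linearizations, so \<open>f\<close> would be convex.  Hence nonconvexity of \<open>f\<close> keeps the numbers \<open>M\<^sub>k\<close>, which
  are at least \<open>\<gamma> * M\<close>, away from zero.
\<close>

lemma lipschitz_grad_const_pos:
  assumes lip: "lipschitz_grad_const n g h L"
  shows "0 < L"
proof (rule ccontr)
  assume "\<not> 0 < L"
  then have "L = 0" using lip by (simp add: lipschitz_grad_const_def)
  have below: "f u' + g u' \<bullet> (u - u') \<le> f u"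
    if u: "u \<in> effdom n h" "u' \<in> effdom n h" for u u'
  proof -
    have "- f u \<le> - f u' + (- g u') \<bullet> (u - u') + 0 / 2 * (norm (u - u'))\<^sup>2"
    proof (rule descent_inequality[of "effdom n h"])
      show "((\<lambda>w. - f w) has_derivative (\<lambda>d. - g w \<bullet> d)) (at w within effdom n h)"
        if "w \<in> effdom n h" for w
        using has_derivative_minus[of f "\<lambda>d. g w \<bullet> d" "at w within effdom n h"]
          f_gradient that by (simp add: gradient_on_def)
      show "norm (- g w - - g w') \<le> 0 * norm (w - w')"
        if "w \<in> effdom n h" "w' \<in> effdom n h" for w w'
      proof -
        have "norm (g w' - g w) \<le> L * norm (w' - w)"
          using lip that by (simp add: lipschitz_grad_const_def)
        then show ?thesis using \<open>L = 0\<close> by (simp add: norm_minus_commute)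
      qed
    qed (use u convex_effdom in auto)
    then show ?thesis by simp
  qed
  have "convex_on (effdom n h) f"
  proof (rule convex_onI[OF _ convex_effdom])
    fix t :: real and u w :: fseq
    assume t: "0 < t" "t < 1" and uw: "u \<in> effdom n h" "w \<in> effdom n h"
    define z where "z = (1 - t) *\<^sub>R u + t *\<^sub>R w"
    have z: "z \<in> effdom n h"
      unfolding z_def using convexD_alt[OF convex_effdom uw] t by simp
    have "(1 - t) *\<^sub>R (u - z) + t *\<^sub>R (w - z) = 0"
      by (simp add: z_def algebra_simps)
    then have "g z \<bullet> ((1 - t) *\<^sub>R (u - z) + t *\<^sub>R (w - z)) = 0" by simp
    then have zero: "(1 - t) * (g z \<bullet> (u - z)) + t * (g z \<bullet> (w - z)) = 0"
      by (simp only: inner_add_right inner_scaleR_right)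
    have "(1 - t) * (f z + g z \<bullet> (u - z)) + t * (f z + g z \<bullet> (w - z))
        \<le> (1 - t) * f u + t * f w"
      using t by (intro add_mono mult_left_mono below uw z) auto
    moreover have "(1 - t) * (f z + r) + t * (f z + s) = f z + ((1 - t) * r + t * s)" for r s
      by (simp add: algebra_simps)
    ultimately show "f ((1 - t) *\<^sub>R u + t *\<^sub>R w) \<le> (1 - t) * f u + t * f w"
      using zero unfolding z_def[symmetric] by simp
  qed
  then show False using f_nonconvex by simp
qed

lemma norm_diff_le_diam:
  "u \<in> effdom n h \<Longrightarrow> u' \<in> effdom n h \<Longrightarrow> norm (u - u') \<le> dom_diam n h"
  unfolding dom_diam_def by (rule cSup_upper[OF _ dom_bounded]) (auto simp: dom_dists_def)

lemma norm_diff_sq_le_diam_sq: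
  "u \<in> effdom n h \<Longrightarrow> u' \<in> effdom n h \<Longrightarrow> (norm (u - u'))\<^sup>2 \<le> (dom_diam n h)\<^sup>2"
  by (intro power_mono norm_diff_le_diam) auto

end

section \<open>Iterates and the subgradient inclusion\<close>

lemma convex_combination_in:
  fixes u w :: "'a::real_vector"
  assumes "convex S" "u \<in> S" "w \<in> S" "0 \<le> r" "0 < s"
  shows "(r *\<^sub>R u + s *\<^sub>R w) /\<^sub>R (r + s) \<in> S"
proof -
  have "(r / (r + s)) *\<^sub>R u + (s / (r + s)) *\<^sub>R w \<in> S"
    using assms by (intro convexD) (auto simp: add_divide_distrib[symmetric])
  then show ?thesis by (simp add: scaleR_add_right divide_inverse mult.commute)
qed

abbreviation (in composite_problem) objective :: "fseq \<Rightarrow> real" where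
  "objective u \<equiv> f u + real_of_ereal (h u)"

context acacg_run
begin

lemma reached_mono: "reached \<rho> v k \<Longrightarrow> j \<le> k \<Longrightarrow> reached \<rho> v j"
  by (simp add: reached_def)

lemma lip_M: "lipschitz_grad_const n g h M"
  unfolding lipschitz_grad_const_def
proof (intro conjI ballI)
  show "0 \<le> M" using Mbar_lipschitz_grad M_ge by (simp add: lipschitz_grad_const_def)
  fix u u' assume u: "u \<in> effdom n h" "u' \<in> effdom n h"
  have "norm (g u - g u') \<le> Mbar n g h * norm (u - u')"
    using Mbar_lipschitz_grad u by (simp add: lipschitz_grad_const_def)
  also have "\<dots> \<le> M * norm (u - u')" using M_ge by (intro mult_right_mono) auto
  finally show "norm (g u - g u') \<le> M * norm (u - u')" .
qed

lemma M_pos: "0 < M"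
  using lip_M by (rule lipschitz_grad_const_pos)

lemma alpha_pos: "0 < acacg_alpha \<gamma>"
  using gamma by (simp add: acacg_alpha_def add_pos_pos)

lemma Ms_ge: "reached \<rho> v k \<Longrightarrow> \<gamma> * M \<le> Ms k"
  by (cases k) (simp_all add: step0 step3_M)

lemma Ms_pos: "reached \<rho> v k \<Longrightarrow> 0 < Ms k"
  using Ms_ge[of k] mult_pos_pos[OF gamma(1) M_pos] by linarith

lemma A_nonneg: "reached \<rho> v k \<Longrightarrow> 0 \<le> A k"
proof (induction k)
  case (Suc k)
  then have k: "reached \<rho> v k" by (auto intro: reached_mono)
  with Suc have "0 \<le> A k" by simp
  then show ?case
    using step_size_quadratic(1)[OF Ms_pos[OF k] _ step1_a[OF k]] step1_A[OF k] by simp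
qed (simp add: step0)

lemma step_size:
  assumes "reached \<rho> v k"
  shows "0 < a k" "Ms k * (a k)\<^sup>2 = A k + a k"
  using step_size_quadratic[OF Ms_pos A_nonneg step1_a, OF assms assms assms] by auto

lemma yg_arg_min:
  assumes "reached \<rho> v k"
  shows "yg (Suc k) \<in> effdom n h"
    and "u \<in> effdom n h \<Longrightarrow>
      linapprox f g (yg (Suc k)) (xt k) + real_of_ereal (h (yg (Suc k)))
        + Ms k / 2 * (norm (yg (Suc k) - xt k))\<^sup>2
      \<le> linapprox f g u (xt k) + real_of_ereal (h u) + Ms k / 2 * (norm (u - xt k))\<^sup>2"
proof -
  note min = arg_min_in_effdom[OF step2_yg[OF assms], where
      G = "\<lambda>u. linapprox f g u (xt k) + real_of_ereal (h u) + Ms k / 2 * (norm (u - xt k))\<^sup>2"]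
  have fin: "ereal (linapprox f g w (xt k)) + h w + ereal (Ms k / 2 * (norm (w - xt k))\<^sup>2)
      = ereal (linapprox f g w (xt k) + real_of_ereal (h w) + Ms k / 2 * (norm (w - xt k))\<^sup>2)"
    if "w \<in> effdom n h" for w
    by (subst h_finite[OF that]) simp
  show "yg (Suc k) \<in> effdom n h" by (rule min(1)[OF fin]) (auto simp: h_infinite)
  show "u \<in> effdom n h \<Longrightarrow>
      linapprox f g (yg (Suc k)) (xt k) + real_of_ereal (h (yg (Suc k)))
        + Ms k / 2 * (norm (yg (Suc k) - xt k))\<^sup>2
      \<le> linapprox f g u (xt k) + real_of_ereal (h u) + Ms k / 2 * (norm (u - xt k))\<^sup>2"
    by (rule min(2)[OF fin]) (auto simp: h_infinite)
qed

lemma x_Suc_arg_min: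
  assumes "reached \<rho> v k"
  shows "x (Suc k) \<in> effdom n h"
    and "u \<in> effdom n h \<Longrightarrow>
      a k * (linapprox f g (x (Suc k)) (xt k) + real_of_ereal (h (x (Suc k))))
        + 1 / 2 * (norm (x (Suc k) - x k))\<^sup>2
      \<le> a k * (linapprox f g u (xt k) + real_of_ereal (h u)) + 1 / 2 * (norm (u - x k))\<^sup>2"
proof -
  note min = arg_min_in_effdom[OF step2_x[OF assms], where
      G = "\<lambda>u. a k * (linapprox f g u (xt k) + real_of_ereal (h u)) + 1 / 2 * (norm (u - x k))\<^sup>2"]
  have fin: "ereal (a k) * (ereal (linapprox f g w (xt k)) + h w)
        + ereal (1 / 2 * (norm (w - x k))\<^sup>2)
      = ereal (a k * (linapprox f g w (xt k) + real_of_ereal (h w)) + 1 / 2 * (norm (w - x k))\<^sup>2)"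
    if "w \<in> effdom n h" for w
    by (subst h_finite[OF that]) simp
  have inf: "ereal (a k) * (ereal (linapprox f g w (xt k)) + h w)
        + ereal (1 / 2 * (norm (w - x k))\<^sup>2) = \<infinity>"
    if "w \<in> Rn n" "w \<notin> effdom n h" for w
    using step_size(1)[OF assms] by (simp add: h_infinite[OF that])
  show "x (Suc k) \<in> effdom n h" by (rule min(1)[OF fin inf])
  show "u \<in> effdom n h \<Longrightarrow>
      a k * (linapprox f g (x (Suc k)) (xt k) + real_of_ereal (h (x (Suc k))))
        + 1 / 2 * (norm (x (Suc k) - x k))\<^sup>2
      \<le> a k * (linapprox f g u (xt k) + real_of_ereal (h u)) + 1 / 2 * (norm (u - x k))\<^sup>2"
    by (rule min(2)[OF fin inf])
qed

text \<open>
  Everything known about \<open>f\<close> concerns the effective domain; being convex, it contains the averages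
  that the method forms.
\<close>

lemma x_y_in_effdom: "reached \<rho> v k \<Longrightarrow> x k \<in> effdom n h \<and> y k \<in> effdom n h"
proof (induction k)
  case 0
  show ?case by (simp add: step0 y0_dom)
next
  case (Suc k)
  then have k: "reached \<rho> v k" by (auto intro: reached_mono)
  have "(A k *\<^sub>R y k + a k *\<^sub>R x (Suc k)) /\<^sub>R A (Suc k) \<in> effdom n h"
    unfolding step1_A[OF k]
    using convex_effdom Suc.IH[OF k] x_Suc_arg_min(1)[OF k] A_nonneg[OF k] step_size(1)[OF k]
    by (intro convex_combination_in) auto
  then show ?case
    using x_Suc_arg_min(1)[OF k] yg_arg_min(1)[OF k] by (simp add: step4[OF Suc.prems])
qed

lemma xt_in_effdom:
  assumes k: "reached \<rho> v k"
  shows "xt k \<in> effdom n h"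
  unfolding step1_xt[OF k] step1_A[OF k]
  using convex_effdom x_y_in_effdom[OF k] A_nonneg[OF k] step_size(1)[OF k]
  by (intro convex_combination_in) auto

text \<open>
  Fermat's rule for the \<open>yg\<close>-update: since the model is \<open>h\<close> plus an affine function with slope
  \<open>g (xt k)\<close>, subtracting this slope from \<open>M\<^sub>k (xt k - yg (Suc k))\<close> leaves a subgradient of \<open>h\<close>.
\<close>

lemma v_in_subdifferential:
  assumes k: "reached \<rho> v k"
  shows "v (Suc k) - g (yg (Suc k)) \<in> subdifferential n h (yg (Suc k))"
proof -
  define z where "z = yg (Suc k)"
  define s where "s = Ms k *\<^sub>R (xt k - z) - g (xt k)"
  have z: "z \<in> effdom n h" unfolding z_def by (rule yg_arg_min(1)[OF k])
  have "g (xt k) \<in> Rn n"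
    using f_gradient xt_in_effdom[OF k] by (simp add: gradient_on_def)
  then have s_Rn: "s \<in> Rn n"
    unfolding s_def
    using effdom_subset[OF xt_in_effdom[OF k]] effdom_subset[OF z]
    by (simp add: subspace_diff subspace_scale subspace_Rn)
  have "h u \<ge> h z + ereal (s \<bullet> (u - z))" if u: "u \<in> Rn n" for u
  proof (cases "u \<in> effdom n h")
    case True
    have "linapprox f g z (xt k) + real_of_ereal (h z) + Ms k * ((xt k - z) \<bullet> (u - z))
        \<le> linapprox f g u (xt k) + real_of_ereal (h u)"
      by (rule proximal_optimality[OF convex_on_model z True])
        (use yg_arg_min(2)[OF k] in \<open>simp add: z_def\<close>)
    then have "real_of_ereal (h z) + s \<bullet> (u - z) \<le> real_of_ereal (h u)"
      by (simp add: s_def linapprox_def inner_simps algebra_simps)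
    then have "ereal (real_of_ereal (h z)) + ereal (s \<bullet> (u - z)) \<le> ereal (real_of_ereal (h u))"
      by simp
    then show ?thesis
      using h_finite[OF z] h_finite[OF True] by metis
  next
    case False
    then show ?thesis using h_infinite[OF u] by simp
  qed
  moreover have "v (Suc k) - g (yg (Suc k)) = s"
    by (simp add: step2_v[OF k] s_def z_def)
  ultimately show ?thesis
    using s_Rn z by (simp add: subdifferential_def z_def)
qed

section \<open>Decrease of the potential\<close>

lemma curvature_le_C: "reached \<rho> v (Suc k) \<Longrightarrow> curvature f g (yg (Suc k)) (xt k) \<le> C k"
  by (simp add: step3_C)

lemma model_error_le_C:
  assumes k: "reached \<rho> v (Suc k)"
  shows "f (yg (Suc k)) \<le> linapprox f g (yg (Suc k)) (xt k)
      + C k / 2 * (norm (yg (Suc k) - xt k))\<^sup>2"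
proof (cases "yg (Suc k) = xt k")
  case False
  then have N: "0 < (norm (yg (Suc k) - xt k))\<^sup>2" by simp
  have "2 * (f (yg (Suc k)) - linapprox f g (yg (Suc k)) (xt k)) / (norm (yg (Suc k) - xt k))\<^sup>2
      \<le> C k"
    using curvature_le_C[OF k] False by (simp add: curvature_def)
  then show ?thesis using N by (simp add: pos_divide_le_eq)
qed (simp add: linapprox_def)

lemma grad_diff_le_C:
  assumes k: "reached \<rho> v (Suc k)"
  shows "norm (g (yg (Suc k)) - g (xt k)) \<le> C k * norm (yg (Suc k) - xt k)"
proof (cases "yg (Suc k) = xt k")
  case False
  have "norm (g (yg (Suc k)) - g (xt k)) / norm (yg (Suc k) - xt k) \<le> C k"
    by (simp add: step3_C[OF k])
  then show ?thesis using False by (simp add: pos_divide_le_eq)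
qed simp

lemma C_nonneg: "reached \<rho> v (Suc k) \<Longrightarrow> 0 \<le> C k"
  by (simp add: step3_C le_max_iff_disj)

text \<open>
  Both quantities under the maximum are bounded by a Lipschitz constant of the gradient: the
  curvature by the descent inequality, the difference quotient directly.
\<close>

lemma C_le_M:
  assumes k: "reached \<rho> v (Suc k)"
  shows "C k \<le> M"
proof -
  have k': "reached \<rho> v k" using k by (auto intro: reached_mono)
  note dom = yg_arg_min(1)[OF k'] xt_in_effdom[OF k']
  show ?thesis
  proof (cases "yg (Suc k) = xt k")
    case True
    then show ?thesis using M_pos by (simp add: step3_C[OF k] curvature_def)
  next
    case False
    then have pos: "0 < (norm (yg (Suc k) - xt k))\<^sup>2" "0 < norm (yg (Suc k) - xt k)" by auto
    have "curvature f g (yg (Suc k)) (xt k) \<le> M"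
      using descent[OF lip_M dom] False pos by (simp add: curvature_def pos_divide_le_eq)
    moreover have "norm (g (yg (Suc k)) - g (xt k)) / norm (yg (Suc k) - xt k) \<le> M"
      using lip_M dom pos by (simp add: lipschitz_grad_const_def pos_divide_le_eq)
    ultimately show ?thesis by (simp add: step3_C[OF k])
  qed
qed

text \<open>
  In a good iteration \<open>C k\<close> is at most \<open>0.9 * Ms k\<close>, so the two summands of \<open>v\<close> contribute at most
  \<open>1.9 * Ms k\<close> times the length of the proximal step, rounded up to \<open>2 * Ms k\<close>.
\<close>

lemma v_norm_le_of_good:
  assumes k: "reached \<rho> v (Suc k)" and good: "C k \<le> 0.9 * Ms k"
  shows "(norm (v (Suc k)))\<^sup>2 \<le> 4 * (Ms k)\<^sup>2 * (norm (yg (Suc k) - xt k))\<^sup>2"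
proof -
  have k': "reached \<rho> v k" using k by (auto intro: reached_mono)
  have "norm (v (Suc k)) = norm (Ms k *\<^sub>R (xt k - yg (Suc k)) + (g (yg (Suc k)) - g (xt k)))"
    by (simp add: step2_v[OF k'] algebra_simps)
  also have "\<dots> \<le> Ms k * norm (yg (Suc k) - xt k) + C k * norm (yg (Suc k) - xt k)"
    using Ms_pos[OF k'] grad_diff_le_C[OF k]
    by (intro order.trans[OF norm_triangle_ineq] add_mono) (auto simp: norm_minus_commute)
  also have "\<dots> = (Ms k + C k) * norm (yg (Suc k) - xt k)" by (simp add: distrib_right)
  also have "\<dots> \<le> (2 * Ms k) * norm (yg (Suc k) - xt k)"
    using good Ms_pos[OF k'] by (intro mult_right_mono) auto
  finally have "(norm (v (Suc k)))\<^sup>2 \<le> ((2 * Ms k) * norm (yg (Suc k) - xt k))\<^sup>2"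
    by (rule power_mono) simp
  then show ?thesis by (simp add: power_mult_distrib)
qed

text \<open>
  This is how weak convexity enters: for convex \<open>f\<close> the model would be a lower bound, and here it is
  one up to the quadratic term.
\<close>

lemma model_le_objective:
  assumes "u \<in> effdom n h" "w \<in> effdom n h"
  shows "linapprox f g u w + real_of_ereal (h u)
    \<le> objective u + mbar n f g h / 2 * (norm (u - w))\<^sup>2"
  using mbar_weakly_convex assms unfolding weakly_convex_const_def by fastforce

text \<open>
  Let \<open>D\<close> be the diameter of the effective domain.  The accelerated step is applied to the model
  at \<open>xt k\<close>.  Replacing the model by the objective at \<open>u\<close> and at \<open>y k\<close> costs \<open>mbar\<close> terms: the
  distance from \<open>y k\<close> to \<open>xt k\<close> has the factor \<open>a k / A (Suc k)\<close>, which reduces the weight \<open>A k\<close> to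
  \<open>a k\<close>, so each of them is at most \<open>mbar * D\<^sup>2 * a k / 2\<close>.  For the new point there are two cases.  In a
  good iteration \<open>yg (Suc k)\<close> beats \<open>yb\<close> in the proximal problem and the observed curvature is at most
  \<open>0.9 * Ms k\<close>, so the multiple \<open>(1 - 0.9) / 2 = 1 / 20\<close> of \<open>Ms k * (norm (yg (Suc k) - xt k))\<^sup>2\<close> is
  left over as decrease.  In a bad iteration the curvature at \<open>yb\<close> is only known to be at most
  \<open>M \<le> Ms k / \<gamma>\<close>, which costs at most \<open>D\<^sup>2 / (2 * \<gamma>)\<close> since the quadratic term at \<open>yb\<close> with its
  weight \<open>A (Suc k)\<close> equals \<open>(norm (x (Suc k) - x k))\<^sup>2 / 2\<close>.  The estimate charges this cost to good
  iterations too, because the final bound allows it \<open>k\<close> times.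
\<close>

lemma potential_step:
  assumes k: "reached \<rho> v (Suc k)" and u: "u \<in> effdom n h"
  shows "A (Suc k) * (objective (y (Suc k)) - objective u) + 1 / 2 * (norm (u - x (Suc k)))\<^sup>2
      + (if C k \<le> 0.9 * Ms k
         then 1 / 20 * (A (Suc k) * Ms k * (norm (yg (Suc k) - xt k))\<^sup>2) else 0)
    \<le> A k * (objective (y k) - objective u) + 1 / 2 * (norm (u - x k))\<^sup>2
      + mbar n f g h * (dom_diam n h)\<^sup>2 * a k + (dom_diam n h)\<^sup>2 / (2 * \<gamma>)"
    (is "?L + ?good \<le> _ + _ + _ + ?bad")
proof -
  define D2 where "D2 = (dom_diam n h)\<^sup>2"
  define m where "m = mbar n f g h"
  define \<psi> where "\<psi> = (\<lambda>w. linapprox f g w (xt k) + real_of_ereal (h w))"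
  define yb where "yb = (A k *\<^sub>R y k + a k *\<^sub>R x (Suc k)) /\<^sub>R (A k + a k)"
  have k': "reached \<rho> v k" using k by (auto intro: reached_mono)
  note a = step_size[OF k'] and A = A_nonneg[OF k'] and A' = step1_A[OF k']
  have xk: "x k \<in> effdom n h" and yk: "y k \<in> effdom n h" using x_y_in_effdom[OF k'] by auto
  note x' = x_Suc_arg_min(1)[OF k'] and xt = xt_in_effdom[OF k']
  have yb: "yb \<in> effdom n h"
    unfolding yb_def using convex_effdom yk x' A a(1) by (rule convex_combination_in)
  have m: "0 \<le> m"
    using mbar_weakly_convex by (simp add: m_def weakly_convex_const_def)
  have D2: "(norm (w - w'))\<^sup>2 \<le> D2" if "w \<in> effdom n h" "w' \<in> effdom n h" for w w'
    unfolding D2_def using that by (rule norm_diff_sq_le_diam_sq)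
  have A'_pos: "0 < A k + a k" using A a(1) by simp

  have "(A k + a k) * (Ms k / 2 * (norm (yb - xt k))\<^sup>2) = 1 / 2 * (norm (x (Suc k) - x k))\<^sup>2"
    and "(A k + a k) * (\<psi> yb + Ms k / 2 * (norm (yb - xt k))\<^sup>2)
      \<le> A k * \<psi> (y k) + a k * \<psi> u + 1 / 2 * (norm (u - x k))\<^sup>2
        - 1 / 2 * (norm (u - x (Suc k)))\<^sup>2"
    using accelerated_step[OF convex_on_model yk u x' a(1) A a(2) x_Suc_arg_min(2)[OF k']
        step1_xt[OF k', unfolded A'] yb_def] by (auto simp: \<psi>_def)
  note quad = this(1) and main = this(2)

  have model_u: "a k * \<psi> u \<le> a k * objective u + m * D2 * a k / 2"
  proof -
    have "\<psi> u \<le> objective u + m / 2 * D2"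
      unfolding \<psi>_def m_def using m unfolding m_def
      by (intro order.trans[OF model_le_objective[OF u xt]] add_left_mono mult_left_mono D2 u xt)
        auto
    then have "a k * \<psi> u \<le> a k * (objective u + m / 2 * D2)"
      using a(1) by (intro mult_left_mono) auto
    then show ?thesis by (simp add: algebra_simps)
  qed

  have model_y: "A k * \<psi> (y k) \<le> A k * objective (y k) + m * D2 * a k / 2"
  proof -
    have "y k - xt k = (a k / (A k + a k)) *\<^sub>R (y k - x k)"
    proof -
      have "(A k + a k) *\<^sub>R xt k = A k *\<^sub>R y k + a k *\<^sub>R x k"
        using A'_pos by (simp add: step1_xt[OF k'] A')
      then have "(A k + a k) *\<^sub>R (y k - xt k) = a k *\<^sub>R (y k - x k)"
        by (simp add: scaleR_diff_right scaleR_add_left)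
      also have "\<dots> = (A k + a k) *\<^sub>R ((a k / (A k + a k)) *\<^sub>R (y k - x k))"
        using A'_pos by simp
      finally have "(A k + a k) *\<^sub>R (y k - xt k)
          = (A k + a k) *\<^sub>R ((a k / (A k + a k)) *\<^sub>R (y k - x k))" .
      moreover have "A k + a k \<noteq> 0" using A'_pos by simp
      ultimately show ?thesis unfolding scaleR_cancel_left by blast
    qed
    then have "(norm (y k - xt k))\<^sup>2 = (a k / (A k + a k))\<^sup>2 * (norm (y k - x k))\<^sup>2"
      by (simp add: power_mult_distrib power_divide)
    also have "\<dots> \<le> (a k / (A k + a k))\<^sup>2 * D2"
      by (intro mult_left_mono D2 yk xk) auto
    finally have dist: "(norm (y k - xt k))\<^sup>2 \<le> (a k / (A k + a k))\<^sup>2 * D2" .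
    have "A k * (a k / (A k + a k))\<^sup>2 = a k * ((A k / (A k + a k)) * (a k / (A k + a k)))"
      by (simp add: power2_eq_square)
    also have "\<dots> \<le> a k * (1 * 1)"
      using A a(1) by (intro mult_left_mono mult_mono) auto
    finally have coeff: "A k * (a k / (A k + a k))\<^sup>2 \<le> a k" by simp
    have D2_nonneg: "0 \<le> D2" by (simp add: D2_def)
    have "A k * \<psi> (y k) \<le> A k * (objective (y k) + m / 2 * ((a k / (A k + a k))\<^sup>2 * D2))"
      unfolding \<psi>_def m_def using m unfolding m_def
      by (intro mult_left_mono A order.trans[OF model_le_objective[OF yk xt]] add_left_mono dist) auto
    also have "\<dots> = A k * objective (y k) + (m * D2 / 2) * (A k * (a k / (A k + a k))\<^sup>2)"
      by (simp add: algebra_simps)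
    also have "\<dots> \<le> A k * objective (y k) + (m * D2 / 2) * a k"
      using m D2_nonneg by (intro add_left_mono mult_left_mono coeff) auto
    finally show ?thesis by simp
  qed

  have upper: "(A k + a k) * (\<psi> yb + Ms k / 2 * (norm (yb - xt k))\<^sup>2)
      \<le> A k * objective (y k) + a k * objective u + m * D2 * a k
        + 1 / 2 * (norm (u - x k))\<^sup>2 - 1 / 2 * (norm (u - x (Suc k)))\<^sup>2"
    using main model_u model_y by linarith

  have lower: "(A k + a k) * objective (y (Suc k)) + ?good
      \<le> (A k + a k) * (\<psi> yb + Ms k / 2 * (norm (yb - xt k))\<^sup>2) + ?bad"
  proof (cases "C k \<le> 0.9 * Ms k")
    case True
    define N where "N = (norm (yg (Suc k) - xt k))\<^sup>2"
    have "f (yg (Suc k)) \<le> linapprox f g (yg (Suc k)) (xt k) + C k / 2 * N"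
      unfolding N_def by (rule model_error_le_C[OF k])
    also have "\<dots> \<le> linapprox f g (yg (Suc k)) (xt k) + (0.9 * Ms k) / 2 * N"
      using True by (intro add_left_mono mult_right_mono divide_right_mono) (auto simp: N_def)
    finally have "objective (yg (Suc k)) + 1 / 20 * (Ms k * N)
        \<le> \<psi> (yg (Suc k)) + Ms k / 2 * N"
      by (simp add: \<psi>_def)
    also have "\<dots> \<le> \<psi> yb + Ms k / 2 * (norm (yb - xt k))\<^sup>2"
      using yg_arg_min(2)[OF k' yb] by (simp add: \<psi>_def N_def)
    finally have "(A k + a k) * (objective (yg (Suc k)) + 1 / 20 * (Ms k * N))
        \<le> (A k + a k) * (\<psi> yb + Ms k / 2 * (norm (yb - xt k))\<^sup>2)"
      using A'_pos by (intro mult_left_mono) auto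
    moreover have "(A k + a k) * (objective (yg (Suc k)) + 1 / 20 * (Ms k * N))
        = (A k + a k) * objective (yg (Suc k)) + 1 / 20 * ((A k + a k) * Ms k * N)"
      by (simp add: algebra_simps)
    moreover have "0 \<le> ?bad" using gamma by simp
    moreover have "y (Suc k) = yg (Suc k)" using True by (simp add: step4[OF k])
    ultimately show ?thesis using True by (simp add: A' N_def)
  next
    case False
    then have y': "y (Suc k) = yb" by (simp add: step4[OF k] yb_def A')
    define N where "N = (norm (yb - xt k))\<^sup>2"
    have "(A k + a k) * (M / 2 * N) = (M / Ms k) * ((A k + a k) * (Ms k / 2 * N))"
      using Ms_pos[OF k'] by simp
    also have "\<dots> = (M / Ms k) * (1 / 2 * (norm (x (Suc k) - x k))\<^sup>2)"
      unfolding N_def quad ..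
    also have "\<dots> \<le> (1 / \<gamma>) * (1 / 2 * D2)"
    proof (intro mult_mono mult_left_mono D2 x' xk)
      have "M / Ms k \<le> M / (\<gamma> * M)"
        using Ms_ge[OF k'] Ms_pos[OF k'] M_pos gamma by (intro divide_left_mono) auto
      then show "M / Ms k \<le> 1 / \<gamma>" using M_pos by simp
    qed (use gamma in auto)
    finally have err: "(A k + a k) * (M / 2 * N) \<le> ?bad" by (simp add: D2_def)
    have "objective yb \<le> \<psi> yb + M / 2 * N"
      using descent[OF lip_M yb xt] by (simp add: \<psi>_def N_def)
    then have "(A k + a k) * objective yb \<le> (A k + a k) * (\<psi> yb + M / 2 * N)"
      using A'_pos by (intro mult_left_mono) auto
    also have "\<dots> = (A k + a k) * \<psi> yb + (A k + a k) * (M / 2 * N)"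
      by (rule distrib_left)
    finally have "(A k + a k) * objective yb \<le> (A k + a k) * \<psi> yb + ?bad"
      using err by linarith
    moreover have "0 \<le> (A k + a k) * (Ms k / 2 * N)"
      using A'_pos Ms_pos[OF k'] by (simp add: N_def)
    moreover have "(A k + a k) * (\<psi> yb + Ms k / 2 * N)
        = (A k + a k) * \<psi> yb + (A k + a k) * (Ms k / 2 * N)"
      by (rule distrib_left)
    ultimately show ?thesis using False unfolding y' N_def by simp
  qed
  have "?L = (A k + a k) * objective (y (Suc k)) - A k * objective u - a k * objective u
      + 1 / 2 * (norm (u - x (Suc k)))\<^sup>2"
    unfolding A' by (simp add: algebra_simps)
  moreover have "A k * (objective (y k) - objective u) = A k * objective (y k) - A k * objective u"
    by (rule right_diff_distrib)
  ultimately show ?thesis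
    using upper lower unfolding m_def D2_def by linarith
qed

lemma potential_sum:
  assumes "u \<in> effdom n h"
  shows "reached \<rho> v k \<Longrightarrow>
    A k * (objective (y k) - objective u) + 1 / 2 * (norm (u - x k))\<^sup>2
      + 1 / 20 * (\<Sum>j\<in>{j. j < k \<and> C j \<le> 0.9 * Ms j}.
          A (Suc j) * Ms j * (norm (yg (Suc j) - xt j))\<^sup>2)
    \<le> 1 / 2 * (dom_diam n h)\<^sup>2 + mbar n f g h * (dom_diam n h)\<^sup>2 * A k
      + real k * ((dom_diam n h)\<^sup>2 / (2 * \<gamma>))"
proof (induction k)
  case 0
  show ?case using norm_diff_sq_le_diam_sq[OF assms y0_dom] by (simp add: step0)
next
  case (Suc k)
  then have k: "reached \<rho> v k" by (auto intro: reached_mono)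
  have set_Suc: "{j. j < Suc k \<and> C j \<le> 0.9 * Ms j}
      = (if C k \<le> 0.9 * Ms k then insert k {j. j < k \<and> C j \<le> 0.9 * Ms j}
         else {j. j < k \<and> C j \<le> 0.9 * Ms j})"
    by (auto simp: less_Suc_eq)
  have "mbar n f g h * (dom_diam n h)\<^sup>2 * A (Suc k)
      = mbar n f g h * (dom_diam n h)\<^sup>2 * A k + mbar n f g h * (dom_diam n h)\<^sup>2 * a k"
    unfolding step1_A[OF k] by (rule distrib_left)
  moreover have "real (Suc k) * ((dom_diam n h)\<^sup>2 / (2 * \<gamma>))
      = real k * ((dom_diam n h)\<^sup>2 / (2 * \<gamma>)) + (dom_diam n h)\<^sup>2 / (2 * \<gamma>)"
    by (simp add: distrib_right add_divide_distrib)
  moreover have "1 / 20 * (\<Sum>j\<in>{j. j < Suc k \<and> C j \<le> 0.9 * Ms j}.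
        A (Suc j) * Ms j * (norm (yg (Suc j) - xt j))\<^sup>2)
      = 1 / 20 * (\<Sum>j\<in>{j. j < k \<and> C j \<le> 0.9 * Ms j}.
        A (Suc j) * Ms j * (norm (yg (Suc j) - xt j))\<^sup>2)
      + (if C k \<le> 0.9 * Ms k
         then 1 / 20 * (A (Suc k) * Ms k * (norm (yg (Suc k) - xt k))\<^sup>2) else 0)"
    unfolding set_Suc by simp
  ultimately show ?case
    using Suc.IH[OF k] potential_step[OF Suc.prems assms] by linarith
qed

text \<open>
  The reference point \<open>u\<close> of the potential is free, and \<open>u = y k\<close> makes the final potential
  nonnegative, so that only the accumulated decrease remains on the left.
\<close>

lemma sum_good_residuals:
  assumes k: "reached \<rho> v k" "1 \<le> k"
  shows "1 / 20 * (\<Sum>j\<in>{j. j < k \<and> C j \<le> 0.9 * Ms j}.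
      A (Suc j) * Ms j * (norm (yg (Suc j) - xt j))\<^sup>2)
    \<le> (dom_diam n h)\<^sup>2 * real k / \<gamma> + mbar n f g h * (dom_diam n h)\<^sup>2 * A k"
proof -
  define D2 where "D2 = (dom_diam n h)\<^sup>2"
  have "1 / 2 * D2 \<le> real k * (D2 / (2 * \<gamma>))"
  proof -
    have "1 \<le> real k / \<gamma>" using k gamma by simp
    then have "1 * (1 / 2 * D2) \<le> real k / \<gamma> * (1 / 2 * D2)"
      by (intro mult_right_mono) (auto simp: D2_def)
    then show ?thesis by simp
  qed
  then have "1 / 2 * D2 + real k * (D2 / (2 * \<gamma>)) \<le> D2 * real k / \<gamma>"
  proof -
    have "D2 * real k / \<gamma> = 2 * (real k * (D2 / (2 * \<gamma>)))" by simp
    then show ?thesis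
      using \<open>1 / 2 * D2 \<le> real k * (D2 / (2 * \<gamma>))\<close> by linarith
  qed
  moreover have "y k \<in> effdom n h" using x_y_in_effdom[OF k(1)] by simp
  then have "1 / 20 * (\<Sum>j\<in>{j. j < k \<and> C j \<le> 0.9 * Ms j}.
      A (Suc j) * Ms j * (norm (yg (Suc j) - xt j))\<^sup>2)
    \<le> 1 / 2 * D2 + mbar n f g h * D2 * A k + real k * (D2 / (2 * \<gamma>))"
  proof -
    have "A k * (objective (y k) - objective (y k)) = 0" by simp
    moreover have "0 \<le> 1 / 2 * (norm (y k - x k))\<^sup>2" by simp
    ultimately show ?thesis
      using potential_sum[OF \<open>y k \<in> effdom n h\<close> k(1)] unfolding D2_def by linarith
  qed
  ultimately show ?thesis unfolding D2_def by linarith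
qed

section \<open>Good iterations and the growth of the weights\<close>

lemma Ms_eq_average:
  assumes "reached \<rho> v k" "1 \<le> k"
  shows "Ms k = max ((\<Sum>i<k. C i) / (acacg_alpha \<gamma> * real k)) (\<gamma> * M)"
proof -
  obtain l where l: "k = Suc l" using assms(2) by (cases k) auto
  have "{0..l} = {..<k}" using l by auto
  then show ?thesis
    using step3_M[of l] assms(1) unfolding l by (simp add: mult.commute)
qed

lemma alpha_le: "acacg_alpha \<gamma> \<le> 0.81 * \<gamma> / 8"
proof -
  have "inverse (1 + 1 / (0.9 * \<gamma>)) \<le> inverse (1 / (0.9 * \<gamma>))"
    using gamma by (intro le_imp_inverse_le) auto
  then show ?thesis by (simp add: acacg_alpha_def)
qed

text \<open>
  This is what the choice of \<open>\<alpha>\<close> achieves.  Let \<open>l\<close> be the last bad index and \<open>b\<close> the number of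
  earlier ones.  Each earlier bad \<open>C i\<close> exceeds \<open>0.9 * Ms i \<ge> 0.9 * \<gamma> * M\<close>, so \<open>Ms l\<close>, which is
  at least the average of the \<open>C i\<close> with \<open>i < l\<close> divided by \<open>\<alpha>\<close>, is at least \<open>0.9 * b * \<gamma> * M / (\<alpha> * l)\<close>.  But \<open>M \<ge> C l > 0.9 * Ms l\<close>, whence
  \<open>0.81 * \<gamma> * b \<le> \<alpha> * l\<close>, and \<open>\<alpha> \<le> 0.81 * \<gamma> / 8\<close>.
\<close>

lemma card_bad_le:
  assumes k: "reached \<rho> v k"
  shows "real (card {j. j < k \<and> \<not> C j \<le> 0.9 * Ms j}) \<le> 1 + real k / 8"
proof (cases "{j. j < k \<and> \<not> C j \<le> 0.9 * Ms j} = {}")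
  case False
  define B where "B = {j. j < k \<and> \<not> C j \<le> 0.9 * Ms j}"
  define l where "l = Max B"
  have fin: "finite B" by (simp add: B_def)
  have "B \<noteq> {}" using False unfolding B_def .
  then have l: "l \<in> B" unfolding l_def using fin by (intro Max_in)
  have below: "i < l" if "i \<in> B - {l}" for i
    using that fin by (auto simp: l_def order.not_eq_order_implies_strict)
  define b where "b = card (B - {l})"
  have reach: "reached \<rho> v i" "reached \<rho> v (Suc i)" if "i \<in> B" for i
    using that k by (auto simp: B_def intro: reached_mono)
  have C_big: "0.9 * (\<gamma> * M) \<le> C i" if "i \<in> B" for i
    using that Ms_ge[OF reach(1)[OF that]] by (simp add: B_def)
  have "real b * (0.9 * (\<gamma> * M)) = (\<Sum>i\<in>B - {l}. 0.9 * (\<gamma> * M))"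
    by (simp add: b_def)
  also have "\<dots> \<le> (\<Sum>i\<in>B - {l}. C i)"
    by (intro sum_mono C_big) auto
  also have "\<dots> \<le> (\<Sum>i<l. C i)"
  proof (rule sum_mono2)
    show "B - {l} \<subseteq> {..<l}" using below by auto
    show "0 \<le> C i" if "i \<in> {..<l} - (B - {l})" for i
      using that l k by (intro C_nonneg) (auto simp: B_def intro: reached_mono)
  qed auto
  finally have sum_C: "real b * (0.9 * (\<gamma> * M)) \<le> (\<Sum>i<l. C i)" .
  have "real b \<le> real l / 8"
  proof (cases "l = 0")
    case True
    have "i \<notin> B - {l}" for i using below[of i] True by blast
    then have "B - {l} = {}" by blast
    then have "b = 0" unfolding b_def by (simp only: card.empty)
    then show ?thesis by simp
  next
    case False
    then have pos: "0 < acacg_alpha \<gamma> * real l" using alpha_pos by simp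
    have "0.9 * (real b * (0.9 * (\<gamma> * M))) / (acacg_alpha \<gamma> * real l)
        \<le> 0.9 * ((\<Sum>i<l. C i) / (acacg_alpha \<gamma> * real l))"
      using divide_right_mono[OF sum_C, of "acacg_alpha \<gamma> * real l"] pos by simp
    also have "\<dots> \<le> 0.9 * Ms l"
      using Ms_eq_average[OF reach(1)[OF l]] False by simp
    also have "\<dots> \<le> M"
      using C_le_M[OF reach(2)[OF l]] l by (simp add: B_def)
    finally have "0.9 * (real b * (0.9 * (\<gamma> * M))) \<le> M * (acacg_alpha \<gamma> * real l)"
      using pos by (simp add: pos_divide_le_eq)
    then have "M * (0.81 * \<gamma> * real b) \<le> M * (acacg_alpha \<gamma> * real l)"
      by (simp add: mult_ac)
    then have "0.81 * \<gamma> * real b \<le> acacg_alpha \<gamma> * real l"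
      using M_pos by simp
    also have "\<dots> \<le> (0.81 * \<gamma> / 8) * real l"
      by (intro mult_right_mono alpha_le) simp
    finally have "(0.81 * \<gamma>) * real b \<le> (0.81 * \<gamma>) * (real l / 8)" by simp
    then show ?thesis using gamma by simp
  qed
  moreover have "l < k" using l by (simp add: B_def)
  moreover have "card B = Suc b"
    unfolding b_def using card_Suc_Diff1[OF fin l] by simp
  ultimately show ?thesis unfolding B_def[symmetric] by simp
next
  case True
  show ?thesis unfolding True by simp
qed

text \<open>
  \<open>k * M\<^sub>k\<close> is the maximum of a sum of nonnegative \<open>C i\<close> (divided by \<open>\<alpha>\<close>) and of \<open>k * \<gamma> * M\<close>, both
  nondecreasing in \<open>k\<close>.  So averaging prevents \<open>Ms\<close> from dropping fast: earlier values exceed \<open>Ms k\<close>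
  by no more than the ratio of the indices.
\<close>

lemma index_times_Ms_mono:
  assumes k: "reached \<rho> v k" and j: "1 \<le> j" "j \<le> k"
  shows "real j * Ms j \<le> real k * Ms k"
proof -
  have j': "reached \<rho> v j" using k j(2) by (rule reached_mono)
  have eq: "real i * Ms i = max ((\<Sum>l<i. C l) / acacg_alpha \<gamma>) (real i * (\<gamma> * M))"
    if "reached \<rho> v i" "1 \<le> i" for i
  proof -
    have "real i * Ms i
        = max (real i * ((\<Sum>l<i. C l) / (acacg_alpha \<gamma> * real i))) (real i * (\<gamma> * M))"
      unfolding Ms_eq_average[OF that] by (rule max_mult_distrib_left[THEN trans]) simp
    then show ?thesis using that(2) by simp
  qed
  have "(\<Sum>l<j. C l) \<le> (\<Sum>l<k. C l)"
    using j k by (intro sum_mono2) (auto intro!: C_nonneg intro: reached_mono)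
  then have "(\<Sum>l<j. C l) / acacg_alpha \<gamma> \<le> (\<Sum>l<k. C l) / acacg_alpha \<gamma>"
    using alpha_pos by (intro divide_right_mono) auto
  moreover have "real j * (\<gamma> * M) \<le> real k * (\<gamma> * M)"
    using j gamma M_pos by (intro mult_right_mono) auto
  ultimately show ?thesis
    unfolding eq[OF j' j(1)] eq[OF k order.trans[OF j]] by (rule max.mono)
qed

lemma Ms_le_of_late:
  assumes "reached \<rho> v k" "1 \<le> j" "j \<le> k" "real k \<le> r * real j"
  shows "Ms j \<le> r * Ms k"
proof -
  have "real j * Ms j \<le> real k * Ms k" by (rule index_times_Ms_mono[OF assms(1-3)])
  also have "\<dots> \<le> (r * real j) * Ms k"
    using assms(4) Ms_pos[OF assms(1)] by (intro mult_right_mono) auto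
  finally have "real j * Ms j \<le> real j * (r * Ms k)" by (simp add: mult_ac)
  then show ?thesis using assms(2) by simp
qed

lemma sqrt_A_Suc_bounds:
  assumes k: "reached \<rho> v k"
  shows "sqrt (A k) + 1 / (2 * sqrt (Ms k)) \<le> sqrt (A (Suc k))"
    and "sqrt (A (Suc k)) \<le> sqrt (A k) + 1 / sqrt (Ms k)"
  using sqrt_step_bounds[OF Ms_pos A_nonneg step1_a, OF k k k] by (simp_all add: step1_A[OF k])

text \<open>
  Only the indices from \<open>k / 4\<close> on are counted: for them \<open>Ms j \<le> 4 * Ms k\<close>, so each step adds at
  least \<open>1 / (4 * sqrt (Ms k))\<close> to \<open>sqrt (A j)\<close>.  The \<open>- 1\<close> covers the index at which the threshold is
  crossed.
\<close>

lemma sqrt_A_lower: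
  assumes k: "reached \<rho> v k" "1 \<le> k"
  shows "j \<le> k \<Longrightarrow> (real j - real k / 4 - 1) / (4 * sqrt (Ms k)) \<le> sqrt (A j)"
proof (induction j)
  case 0
  have "(0 - real k / 4 - 1) / (4 * sqrt (Ms k)) \<le> 0"
    using Ms_pos[OF k(1)] by (intro divide_nonpos_pos) auto
  then show ?case by (simp add: step0)
next
  case (Suc j)
  then have j: "reached \<rho> v j" using reached_mono[OF k(1)] by auto
  show ?case
  proof (cases "k \<le> 4 * j")
    case True
    have "Ms j \<le> 4 * Ms k"
      using True Suc.prems k by (intro Ms_le_of_late) auto
    then have "sqrt (Ms j) \<le> 2 * sqrt (Ms k)"
      using real_sqrt_le_mono[of "Ms j" "4 * Ms k"] by (simp add: real_sqrt_mult)
    then have "1 / (2 * (2 * sqrt (Ms k))) \<le> 1 / (2 * sqrt (Ms j))"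
      using Ms_pos[OF j] by (intro divide_left_mono) (auto simp: Ms_pos[OF k(1)])
    moreover have "(real (Suc j) - real k / 4 - 1) / (4 * sqrt (Ms k))
        = (real j - real k / 4 - 1) / (4 * sqrt (Ms k)) + 1 / (2 * (2 * sqrt (Ms k)))"
      by (simp add: add_divide_distrib diff_divide_distrib)
    ultimately show ?thesis
      using Suc sqrt_A_Suc_bounds(1)[OF j] by simp
  next
    case False
    then have "(real (Suc j) - real k / 4 - 1) / (4 * sqrt (Ms k)) \<le> 0"
      using Ms_pos[OF k(1)] by (intro divide_nonpos_pos) auto
    moreover have "0 \<le> sqrt (A (Suc j))"
      using A_nonneg[OF reached_mono[OF k(1) Suc.prems]] by simp
    ultimately show ?thesis by linarith
  qed
qed

lemma theta_ge:
  assumes "i \<le> k"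
  shows "Ms k / Ms i \<le> acacg_theta Ms k"
proof -
  have "{Ms k / Ms i |i. 0 \<le> i \<and> i \<le> k} = (\<lambda>i. Ms k / Ms i) ` {..k}" by auto
  then show ?thesis using assms unfolding acacg_theta_def by (auto intro!: Max_ge)
qed

lemma theta_ge_1: "reached \<rho> v k \<Longrightarrow> 1 \<le> acacg_theta Ms k"
  using theta_ge[of k k] Ms_pos[of k] by simp

text \<open>
  Each step adds at most \<open>1 / sqrt (Ms j) \<le> sqrt (\<theta>\<^sub>k / Ms k)\<close> to \<open>sqrt (A j)\<close>, because
  \<open>Ms k / Ms j \<le> \<theta>\<^sub>k\<close>.
\<close>

lemma A_upper:
  assumes k: "reached \<rho> v k"
  shows "A k \<le> (real k)\<^sup>2 * acacg_theta Ms k / Ms k"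
proof -
  define q where "q = acacg_theta Ms k / Ms k"
  have q: "0 \<le> q" using theta_ge_1[OF k] Ms_pos[OF k] by (simp add: q_def)
  have "sqrt (A j) \<le> real j * sqrt q" if "j \<le> k" for j
    using that
  proof (induction j)
    case (Suc j)
    then have j: "reached \<rho> v j" using reached_mono[OF k] by auto
    have "Ms k / Ms j / Ms k \<le> q"
      unfolding q_def using theta_ge[of j k] Suc.prems Ms_pos[OF k]
      by (intro divide_right_mono) auto
    then have "sqrt (1 / Ms j) \<le> sqrt q"
      using Ms_pos[OF k] by (intro real_sqrt_le_mono) simp
    then have "1 / sqrt (Ms j) \<le> sqrt q" by (simp add: real_sqrt_divide)
    then show ?case
      using Suc sqrt_A_Suc_bounds(2)[OF j] by (simp add: distrib_right)
  qed (simp add: step0)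
  then have "sqrt (A k) \<le> real k * sqrt q" by simp
  then have "(sqrt (A k))\<^sup>2 \<le> (real k * sqrt q)\<^sup>2"
    using A_nonneg[OF k] by (intro power_mono) auto
  then show ?thesis
    using A_nonneg[OF k] q by (simp add: power_mult_distrib q_def)
qed

section \<open>The complexity bound\<close>

text \<open>
  At least \<open>k / 2 - 1 / 2\<close> indices lie in the second half and at most \<open>1 + k / 8\<close> are bad; what is left,
  \<open>3 * k / 8 - 3 / 2\<close>, is at least \<open>k / 4\<close> precisely when \<open>k \<ge> 12\<close>.
\<close>

lemma card_late_good_ge:
  assumes k: "reached \<rho> v k" "12 \<le> k"
  shows "real k / 4 \<le> real (card {j. j < k \<and> k \<le> 2 * j \<and> C j \<le> 0.9 * Ms j})"
    (is "_ \<le> real (card ?G)")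
proof -
  define G where "G = ?G"
  define B where "B = {j. j < k \<and> \<not> C j \<le> 0.9 * Ms j}"
  have "card {(k + 1) div 2..<k} \<le> card (G \<union> B)"
    by (rule card_mono) (auto simp: G_def B_def)
  also have "\<dots> \<le> card G + card B" by (rule card_Un_le)
  finally have "k \<le> card G + card B + (k + 1) div 2" by simp
  then have "2 * k \<le> 2 * (card G + card B) + (k + 1)" by presburger
  then have "2 * real k \<le> 2 * (real (card G) + real (card B)) + (real k + 1)"
    by (metis (no_types, lifting) of_nat_1 of_nat_add of_nat_mono of_nat_mult of_nat_numeral)
  moreover have "real (card B) \<le> 1 + real k / 8"
    unfolding B_def by (rule card_bad_le[OF k(1)])
  moreover have "12 \<le> real k" using k(2) by simp
  moreover have "K / 4 \<le> G'"
    if "2 * K \<le> 2 * (G' + B') + (K + 1)" "B' \<le> 1 + K / 8" "12 \<le> K" for K G' B' :: real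
    using that by (simp add: field_simps)
  ultimately have "real k / 4 \<le> real (card G)" by blast
  then show ?thesis unfolding G_def .
qed

text \<open>
  Late indices have \<open>Ms j \<le> 2 * Ms k\<close> and \<open>A (Suc j) \<ge> k\<^sup>2 / (256 * Ms k)\<close>, and in a good iteration
  the step length controls \<open>v\<close> up to the factor \<open>2 * Ms j\<close>; the constant is \<open>256 * 4 * 2 = 2048\<close>.
\<close>

lemma late_good_residual:
  assumes k: "reached \<rho> v k" "1 \<le> k"
    and j: "j < k" "k \<le> 2 * j" "C j \<le> 0.9 * Ms j"
  shows "(norm (v (Suc j)))\<^sup>2 * ((real k)\<^sup>2 / (2048 * (Ms k)\<^sup>2))
    \<le> A (Suc j) * Ms j * (norm (yg (Suc j) - xt j))\<^sup>2"
proof -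
  define N where "N = (norm (yg (Suc j) - xt j))\<^sup>2"
  have j': "reached \<rho> v j" "reached \<rho> v (Suc j)"
    using reached_mono[OF k(1)] j(1) by auto
  have Mk: "0 < Ms k" and Mj: "0 < Ms j" using Ms_pos k j' by auto
  have "real k / (16 * sqrt (Ms k)) \<le> (real (Suc j) - real k / 4 - 1) / (4 * sqrt (Ms k))"
  proof -
    have "real k / 4 \<le> real (Suc j) - real k / 4 - 1" using j(2) by simp
    then have "real k / 4 / (4 * sqrt (Ms k)) \<le> (real (Suc j) - real k / 4 - 1) / (4 * sqrt (Ms k))"
      using Mk by (intro divide_right_mono) auto
    then show ?thesis by simp
  qed
  also have "\<dots> \<le> sqrt (A (Suc j))"
    using sqrt_A_lower[OF k, of "Suc j"] j(1) by simp
  finally have "(real k / (16 * sqrt (Ms k)))\<^sup>2 \<le> (sqrt (A (Suc j)))\<^sup>2"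
    using Mk by (intro power_mono) auto
  then have A_ge: "(real k)\<^sup>2 / (256 * Ms k) \<le> A (Suc j)"
    using Mk A_nonneg[OF j'(2)] by (simp add: power_divide power_mult_distrib)
  have "Ms j \<le> 2 * Ms k"
    using j k by (intro Ms_le_of_late) auto
  then have inv: "1 / (4 * (2 * Ms k)) \<le> 1 / (4 * Ms j)"
    using Mj Mk by (intro divide_left_mono) auto
  have "(norm (v (Suc j)))\<^sup>2 * ((real k)\<^sup>2 / (2048 * (Ms k)\<^sup>2))
      = (norm (v (Suc j)))\<^sup>2 * (((real k)\<^sup>2 / (256 * Ms k)) * (1 / (4 * (2 * Ms k))))"
    by (simp add: power2_eq_square)
  also have "\<dots> \<le> (norm (v (Suc j)))\<^sup>2 * (A (Suc j) * (1 / (4 * Ms j)))"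
    using Mk A_nonneg[OF j'(2)] by (intro mult_left_mono mult_mono A_ge inv) auto
  also have "\<dots> \<le> (4 * (Ms j)\<^sup>2 * N) * (A (Suc j) * (1 / (4 * Ms j)))"
    unfolding N_def using A_nonneg[OF j'(2)] Mj
    by (intro mult_right_mono v_norm_le_of_good[OF j'(2) j(3)]) auto
  also have "\<dots> = A (Suc j) * Ms j * N"
    using Mj by (simp add: power2_eq_square)
  finally show ?thesis unfolding N_def .
qed

text \<open>
  Each of at least \<open>k / 4\<close> late good iterations contributes at least \<open>V * k\<^sup>2 / (2048 * (Ms k)\<^sup>2)\<close> to the
  sum bounded in \<open>sum_good_residuals\<close>.  Together with the upper bound on \<open>A k\<close>, solving for \<open>V\<close> gives
  the constant \<open>163840 = 20 * 4 * 2048\<close>.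
\<close>

lemma min_residual_bound:
  assumes k: "reached \<rho> v k" "12 \<le> k"
    and V: "0 \<le> V" "\<And>i. 1 \<le> i \<Longrightarrow> i \<le> k \<Longrightarrow> V \<le> (norm (v i))\<^sup>2"
  shows "V \<le> 163840 * ((Ms k)\<^sup>2 * (dom_diam n h)\<^sup>2 / (\<gamma> * (real k)\<^sup>2)
    + acacg_theta Ms k * mbar n f g h * Ms k * (dom_diam n h)\<^sup>2 / real k)"
proof -
  define D2 where "D2 = (dom_diam n h)\<^sup>2"
  define m where "m = mbar n f g h"
  define \<theta> where "\<theta> = acacg_theta Ms k"
  define G where "G = {j. j < k \<and> k \<le> 2 * j \<and> C j \<le> 0.9 * Ms j}"
  define w where "w = (real k)\<^sup>2 / (2048 * (Ms k)\<^sup>2)"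
  have Mk: "0 < Ms k" using k(1) by (rule Ms_pos)
  have k1: "1 \<le> k" using k(2) by simp
  have m: "0 \<le> m" using mbar_weakly_convex by (simp add: m_def weakly_convex_const_def)
  have w: "0 < w" using Mk k1 by (simp add: w_def)

  have "real k / 4 * (V * w) \<le> real (card G) * (V * w)"
    using card_late_good_ge[OF k] V(1) w unfolding G_def by (intro mult_right_mono) auto
  also have "\<dots> = (\<Sum>j\<in>G. V * w)" by simp
  also have "\<dots> \<le> (\<Sum>j\<in>G. A (Suc j) * Ms j * (norm (yg (Suc j) - xt j))\<^sup>2)"
  proof (rule sum_mono)
    fix j assume j: "j \<in> G"
    have "V * w \<le> (norm (v (Suc j)))\<^sup>2 * w"
      using V(2)[of "Suc j"] j w by (intro mult_right_mono) (auto simp: G_def)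
    also have "\<dots> \<le> A (Suc j) * Ms j * (norm (yg (Suc j) - xt j))\<^sup>2"
      unfolding w_def using j by (intro late_good_residual[OF k(1) k1]) (auto simp: G_def)
    finally show "V * w \<le> A (Suc j) * Ms j * (norm (yg (Suc j) - xt j))\<^sup>2" .
  qed
  also have "\<dots> \<le> (\<Sum>j\<in>{j. j < k \<and> C j \<le> 0.9 * Ms j}.
      A (Suc j) * Ms j * (norm (yg (Suc j) - xt j))\<^sup>2)"
  proof (rule sum_mono2)
    fix j assume "j \<in> {j. j < k \<and> C j \<le> 0.9 * Ms j} - G"
    then have "reached \<rho> v j" "reached \<rho> v (Suc j)" using reached_mono[OF k(1)] by auto
    then show "0 \<le> A (Suc j) * Ms j * (norm (yg (Suc j) - xt j))\<^sup>2"
      using A_nonneg[of "Suc j"] Ms_pos[of j] by simp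
  qed (auto simp: G_def)
  finally have "1 / 20 * (real k / 4 * (V * w)) \<le> D2 * real k / \<gamma> + m * D2 * A k"
    using sum_good_residuals[OF k(1) k1] unfolding D2_def m_def by linarith
  also have "\<dots> \<le> D2 * real k / \<gamma> + m * D2 * ((real k)\<^sup>2 * \<theta> / Ms k)"
    unfolding \<theta>_def using m by (intro add_left_mono mult_left_mono A_upper k) (auto simp: D2_def)
  finally have "V * (real k * w / 80) \<le> D2 * real k / \<gamma> + m * D2 * ((real k)\<^sup>2 * \<theta> / Ms k)"
    by (simp add: mult_ac)
  then have "V \<le> (D2 * real k / \<gamma> + m * D2 * ((real k)\<^sup>2 * \<theta> / Ms k)) / (real k * w / 80)"
    using w k1 by (subst pos_le_divide_eq) auto
  also have "\<dots> = 163840 * ((Ms k)\<^sup>2 * D2 / (\<gamma> * (real k)\<^sup>2) + \<theta> * m * Ms k * D2 / real k)"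
  proof -
    have inv_w: "real k * w / 80 = real k ^ 3 / (163840 * (Ms k)\<^sup>2)"
      by (simp add: w_def power2_eq_square power3_eq_cube)
    have "D2 * real k / \<gamma> / (real k ^ 3 / (163840 * (Ms k)\<^sup>2))
        = 163840 * ((Ms k)\<^sup>2 * D2 / (\<gamma> * (real k)\<^sup>2))"
      using k1 by (simp add: power2_eq_square power3_eq_cube)
    moreover have "m * D2 * ((real k)\<^sup>2 * \<theta> / Ms k) / (real k ^ 3 / (163840 * (Ms k)\<^sup>2))
        = 163840 * (\<theta> * m * Ms k * D2 / real k)"
      using k1 Mk by (simp add: power2_eq_square power3_eq_cube)
    ultimately show ?thesis
      unfolding inv_w add_divide_distrib distrib_left by simp
  qed
  finally show ?thesis unfolding D2_def m_def \<theta>_def .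
qed

end

theorem theorem2p1:
  shows "\<exists>c::real. c > 0 \<and>
    (\<forall>n f g h \<gamma> M \<rho> y0 A a Ms C x y xt yg v.
      acacg_run n f g h \<gamma> M \<rho> y0 A a Ms C x y xt yg v \<longrightarrow>
        (\<forall>k\<ge>1. reached \<rho> v (k - 1) \<longrightarrow>
           v k \<in> {g (yg k) + s |s. s \<in> subdifferential n h (yg k)}) \<and>
        (\<forall>k\<ge>12. reached \<rho> v k \<longrightarrow>
           acacg_theta Ms k \<ge> 1 \<and>
           Min {(norm (v i))\<^sup>2 |i. 1 \<le> i \<and> i \<le> k}
             \<le> c * ((Ms k)\<^sup>2 * (dom_diam n h)\<^sup>2 / (\<gamma> * (real k)\<^sup>2)
                    + acacg_theta Ms k * mbar n f g h * Ms k * (dom_diam n h)\<^sup>2 / real k)))"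
proof (intro exI[of _ 163840] conjI allI impI)
  fix n f g h \<gamma> M \<rho> y0 A a Ms C x y xt yg v
  assume "acacg_run n f g h \<gamma> M \<rho> y0 A a Ms C x y xt yg v"
  then interpret acacg_run n f g h \<gamma> M \<rho> y0 A a Ms C x y xt yg v .
  fix k :: nat
  show "v k \<in> {g (yg k) + s |s. s \<in> subdifferential n h (yg k)}"
    if "1 \<le> k" "reached \<rho> v (k - 1)"
  proof -
    have "v k - g (yg k) \<in> subdifferential n h (yg k)"
      using v_in_subdifferential[OF that(2)] that(1) by simp
    then show ?thesis
      by (intro CollectI exI[of _ "v k - g (yg k)"]) simp
  qed
  assume k: "12 \<le> k" "reached \<rho> v k"
  show "acacg_theta Ms k \<ge> 1" using k(2) by (rule theta_ge_1)
  have set_eq: "{(norm (v i))\<^sup>2 |i. 1 \<le> i \<and> i \<le> k} = (\<lambda>i. (norm (v i))\<^sup>2) ` {1..k}" by auto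
  show "Min {(norm (v i))\<^sup>2 |i. 1 \<le> i \<and> i \<le> k}
      \<le> 163840 * ((Ms k)\<^sup>2 * (dom_diam n h)\<^sup>2 / (\<gamma> * (real k)\<^sup>2)
        + acacg_theta Ms k * mbar n f g h * Ms k * (dom_diam n h)\<^sup>2 / real k)"
    unfolding set_eq using k by (intro min_residual_bound) (auto intro: Min_le)
qed simp

end
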